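(* Let $H$ be a Hilbert space and let $(C_n)_{n\ge 1}$ be any sequence in $B(H)$ such that $$\Big\|\sum_n \alpha_n C_n\Big\|_{B(H)}\le \Big(\sum_n|\alpha_n|^2\Big)^{1/2}\qquad\text{for all }(\alpha_n)\in\ell_2 .$$ Let $(K_n)_{n\ge 1}$ be an increasing sequence of positive integers such that $2^{n-1}<K_n\le 2^n$ for all $n>1$. Consider the operator $u:A\to B(H)$ defined by $u(F)=\sum_{n\ge 1}\hat F(K_n)\,C_n$. Then there is a function $\varphi\in L^\infty(B(H))$ such that the associated vectorial Hankel operator $\Gamma=\Gamma_\varphi:H^2(H)\to H^2(H)^*$ satisfies: (i) there is a constant $C$ such that $\|\Gamma M_{f'}\|\le C\|f\|_\infty$ for every polynomial $f$; (ii) for every polynomial $P$ (with derived polynomial $P'$) and all $x,y\in H$, $$\langle u(P)x,\overline{y}\rangle=\Gamma[P'(1\otimes x)](1\otimes y).$$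
   Context: $\mathbb{T}$ is the unit circle with normalized Lebesgue measure $m$. $A$ is the disc algebra: the closure of the analytic polynomials in $C(\mathbb{T})$, with the sup norm $\|\cdot\|_\infty$ over $\mathbb{T}$; $\hat F(n)$ denotes the $n$-th Fourier (Taylor) coefficient of $F$. $H$ is a complex Hilbert space, identified with $\ell_2(I)$ for some set $I$. $H^2(H)$ is the Hardy space of $H$-valued functions in $L^2(\mathbb{T},m;H)$ with vanishing negative Fourier coefficients, and $H^2(H)^*$ is its Banach space dual; an operator $\Gamma:H^2(H)\to H^2(H)^*$ is identified with the bilinear form $\Gamma(g,h)=\Gamma[g](h)$. $L^\infty(B(H))$ is the space of (classes of) bounded $B(H)$-valued functions on $\mathbb{T}$ all of whose matrix coefficients are measurable. Fix an antilinear isometry $y\mapsto\overline{y}$ of $H$ onto $H$ and put $[x,y]=\langle x,\overline{y}\rangle$, a bilinear form on $H\times H$ corresponding to an isometry between $H$ and $H^*$. For $\varphi\in L^\infty(B(H))$ the vectorial Hankel operator $\Gamma_\varphi:H^2(H)\to H^2(H)^*$ is defined by $\Gamma_\varphi(g,h)=\int_{\mathbb{T}}[\varphi(\xi)g(\xi),h(\xi)]\,dm(\xi)$ for $g,h\in H^2(H)$. For $f\in A$, $M_f:H^2(H)\to H^2(H)$ is multiplication by $f$. For $x\in H$, $1\otimes x\in H^2(H)$ is the function constantly equal to $x$, and $P'(1\otimes x)$ is the function $z\mapsto P'(z)x$. *)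

theory Defs
  imports "HOL-Analysis.Analysis" "HOL-Computational_Algebra.Polynomial"
begin

class scaleC =
  fixes scaleC :: "complex \<Rightarrow> 'a \<Rightarrow> 'a"  (infixr "*\<^sub>C" 75)

text \<open>Complex Hilbert spaces. The inner product is linear in its first argument, and its real part
  is the inner product of \<^class>\<open>real_inner\<close>, so that norm and topology are the inherited ones.\<close>

class complex_hilbert_space = scaleC + real_inner + complete_space +
  fixes cinner :: "'a \<Rightarrow> 'a \<Rightarrow> complex"
  assumes scaleR_scaleC: "r *\<^sub>R x = complex_of_real r *\<^sub>C x"
    and scaleC_add_right: "a *\<^sub>C (x + y) = a *\<^sub>C x + a *\<^sub>C y"
    and scaleC_add_left: "(a + b) *\<^sub>C x = a *\<^sub>C x + b *\<^sub>C x"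
    and scaleC_scaleC: "a *\<^sub>C (b *\<^sub>C x) = (a * b) *\<^sub>C x"
    and scaleC_one: "1 *\<^sub>C x = x"
    and cinner_commute: "cinner x y = cnj (cinner y x)"
    and cinner_add_left: "cinner (x + y) z = cinner x z + cinner y z"
    and cinner_scaleC_left: "cinner (a *\<^sub>C x) y = a * cinner x y"
    and inner_eq_Re_cinner: "inner x y = Re (cinner x y)"

lemma norm_scaleC: "norm (a *\<^sub>C x) = cmod a * norm x"
  for x :: "'a::complex_hilbert_space"
proof -
  have "cinner (a *\<^sub>C x) (a *\<^sub>C x) = a * cnj (cinner (a *\<^sub>C x) x)"
    using cinner_scaleC_left[of a x "a *\<^sub>C x"] cinner_commute[of x "a *\<^sub>C x"] by metis
  also have "\<dots> = a * cnj a * cinner x x"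
    using cinner_scaleC_left[of a x x] cinner_commute[of x x] by simp
  finally have "inner (a *\<^sub>C x) (a *\<^sub>C x) = Re (a * cnj a * cinner x x)"
    by (simp add: inner_eq_Re_cinner)
  also have "\<dots> = (cmod a)\<^sup>2 * inner x x"
    unfolding inner_eq_Re_cinner complex_norm_square[symmetric] by simp
  finally show ?thesis
    by (simp add: norm_eq_sqrt_inner real_sqrt_mult)
qed

lemma scaleR_scaleC_commute: "a *\<^sub>C r *\<^sub>R x = r *\<^sub>R a *\<^sub>C x"
  for x :: "'a::complex_hilbert_space"
  by (simp add: scaleR_scaleC scaleC_scaleC mult.commute)

lemma bounded_linear_scaleC:
  fixes f :: "'b::real_normed_vector \<Rightarrow> 'a::complex_hilbert_space"
  assumes "bounded_linear f"
  shows "bounded_linear (\<lambda>x. a *\<^sub>C f x)"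
proof -
  have "bounded_linear (\<lambda>y::'a. a *\<^sub>C y)"
    by (rule bounded_linear_intro[where K = "cmod a"])
      (simp_all add: scaleC_add_right scaleR_scaleC_commute norm_scaleC mult.commute)
  from bounded_linear_compose[OF this assms] show ?thesis .
qed

instantiation blinfun :: (real_normed_vector, complex_hilbert_space) scaleC
begin

lift_definition scaleC_blinfun :: "complex \<Rightarrow> 'a \<Rightarrow>\<^sub>L 'b \<Rightarrow> 'a \<Rightarrow>\<^sub>L 'b"
  is "\<lambda>a f x. a *\<^sub>C f x"
  by (rule bounded_linear_scaleC)

instance ..

end

text \<open>\<open>B(H)\<close>: the complex-linear elements of the space of real-linear bounded operators. The operator
  norm is that of \<^type>\<open>blinfun\<close>.\<close>

definition bounded_clinear_ops :: "('h::complex_hilbert_space \<Rightarrow>\<^sub>L 'h) set" where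
  "bounded_clinear_ops = {T. \<forall>a x. blinfun_apply T (a *\<^sub>C x) = a *\<^sub>C blinfun_apply T x}"

definition antilinear_isometry :: "('h::complex_hilbert_space \<Rightarrow> 'h) \<Rightarrow> bool" where
  "antilinear_isometry J \<longleftrightarrow>
     (\<forall>x y. J (x + y) = J x + J y) \<and> (\<forall>a x. J (a *\<^sub>C x) = cnj a *\<^sub>C J x) \<and> (\<forall>x. norm (J x) = norm x)"

abbreviation unit_circle :: "complex set" where
  "unit_circle \<equiv> sphere 0 1"

text \<open>Normalized Lebesgue measure; the completion makes the measurable sets the Lebesgue measurable
  subsets of the circle, not just the Borel ones.\<close>

definition circle_measure :: "complex measure" where
  "circle_measure =
     completion (distr (uniform_measure lborel {0..2 * pi}) (restrict_space borel unit_circle) cis)"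

definition fourier_coeff :: "(complex \<Rightarrow> complex) \<Rightarrow> int \<Rightarrow> complex" where
  "fourier_coeff F n = integral\<^sup>L circle_measure (\<lambda>z. z powi (- n) * F z)"

definition circle_sup_norm :: "(complex \<Rightarrow> complex) \<Rightarrow> real" where
  "circle_sup_norm F = (SUP z\<in>unit_circle. cmod (F z))"

text \<open>The disc algebra, as a space of functions on the circle.\<close>

definition disc_algebra :: "(complex \<Rightarrow> complex) set" where
  "disc_algebra = {F. continuous_on unit_circle F \<and>
     (\<forall>e>0. \<exists>p. \<forall>z\<in>unit_circle. cmod (F z - poly p z) < e)}"

text \<open>Elements of \<open>L\<^sup>2\<close>, \<open>H\<^sup>2\<close> and \<open>L\<^sup>\<infinity>\<close> are represented by functions, of which only the values on the
  circle matter. \<open>H\<close> need not be separable, so Bochner measurability is spelled out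
  (\<^const>\<open>integrable\<close> for vector-valued functions requires second countability).\<close>

definition strongly_measurable :: "'a measure \<Rightarrow> ('a \<Rightarrow> 'b::topological_space) \<Rightarrow> bool" where
  "strongly_measurable M f \<longleftrightarrow>
     (\<exists>s. (\<forall>n. simple_function M (s n)) \<and> (AE x in M. (\<lambda>n. s n x) \<longlonglongrightarrow> f x))"

definition L2_circle :: "(complex \<Rightarrow> 'h::complex_hilbert_space) set" where
  "L2_circle = {g. strongly_measurable circle_measure g \<and> integrable circle_measure (\<lambda>z. (norm (g z))\<^sup>2)}"

definition L2_circle_norm :: "(complex \<Rightarrow> 'h::complex_hilbert_space) \<Rightarrow> real" where
  "L2_circle_norm g = sqrt (integral\<^sup>L circle_measure (\<lambda>z. (norm (g z))\<^sup>2))"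

text \<open>The vector \<open>c\<close> is the \<open>n\<close>-th Fourier coefficient of \<open>g\<close>, the defining integral
  being evaluated weakly.\<close>

definition has_fourier_coeff :: "(complex \<Rightarrow> 'h::complex_hilbert_space) \<Rightarrow> int \<Rightarrow> 'h \<Rightarrow> bool" where
  "has_fourier_coeff g n c \<longleftrightarrow> (\<forall>y. fourier_coeff (\<lambda>z. cinner (g z) y) n = cinner c y)"

definition hardy2 :: "(complex \<Rightarrow> 'h::complex_hilbert_space) set" where
  "hardy2 = {g \<in> L2_circle. \<forall>n<0. has_fourier_coeff g n 0}"

definition Linf_ops :: "(complex \<Rightarrow> 'h::complex_hilbert_space \<Rightarrow>\<^sub>L 'h) set" where
  "Linf_ops = {\<phi>. (\<forall>z\<in>unit_circle. \<phi> z \<in> bounded_clinear_ops) \<and>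
     (\<exists>B. \<forall>z\<in>unit_circle. norm (\<phi> z) \<le> B) \<and>
     (\<forall>x y. (\<lambda>z. cinner (blinfun_apply (\<phi> z) x) y) \<in> borel_measurable circle_measure)}"

text \<open>The norm of a functional on \<open>H\<^sup>2(H)\<close> and of an operator from \<open>H\<^sup>2(H)\<close> to its dual.
  They are extended reals, so that an unbounded functional or operator gets norm \<open>\<infinity>\<close>.\<close>

definition hardy2_dual_norm :: "((complex \<Rightarrow> 'h::complex_hilbert_space) \<Rightarrow> complex) \<Rightarrow> ennreal" where
  "hardy2_dual_norm l = (SUP h\<in>{h \<in> hardy2. L2_circle_norm h \<le> 1}. ennreal (cmod (l h)))"

definition hardy2_op_norm ::
  "((complex \<Rightarrow> 'h::complex_hilbert_space) \<Rightarrow> (complex \<Rightarrow> 'h) \<Rightarrow> complex) \<Rightarrow> ennreal" where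
  "hardy2_op_norm \<Gamma> = (SUP g\<in>{g \<in> hardy2. L2_circle_norm g \<le> 1}. hardy2_dual_norm (\<Gamma> g))"

definition mult_op ::
  "(complex \<Rightarrow> complex) \<Rightarrow> (complex \<Rightarrow> 'h::complex_hilbert_space) \<Rightarrow> complex \<Rightarrow> 'h" where
  "mult_op f g = (\<lambda>z. f z *\<^sub>C g z)"

text \<open>The vectorial Hankel operator with symbol \<open>\<phi>\<close>; \<open>J\<close> is the conjugation of \<open>H\<close>.\<close>

definition hankel_op ::
  "('h::complex_hilbert_space \<Rightarrow> 'h) \<Rightarrow> (complex \<Rightarrow> 'h \<Rightarrow>\<^sub>L 'h) \<Rightarrow>
    (complex \<Rightarrow> 'h) \<Rightarrow> (complex \<Rightarrow> 'h) \<Rightarrow> complex" where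
  "hankel_op J \<phi> g h =
     integral\<^sup>L circle_measure (\<lambda>z. cinner (blinfun_apply (\<phi> z) (g z)) (J (h z)))"

end

(* The symbol is phi(z) = sum_n cnj z^(K_n - 1) C_n / K_n, and (ii) is a comparison of Fourier
   coefficients. For (i), let g and h be H-valued polynomials; the functions F_n = <C_n g, J h> are
   analytic, and the form of Gamma M_{f'} at (g, h) is the sum over n of the coefficients of index
   K_n - 1 of f' F_n / K_n. Factor g = p (g / p) with a scalar p of comparable L2 norm satisfying
   |p| >= |g| on the circle. The coefficient of index K_n - 1 of f' F_n sees only the Taylor
   polynomial of f' p of degree < K_n, so at each point the sum becomes a scalar combination of the
   C_n applied to the single vector g / p. The l2 hypothesis on (C_n), lacunarity and the
   Cauchy-Schwarz inequality then reduce the bound to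
   sum_k |(f' p)^(k)|^2 / (k + 1)^2 <= c ||f||_inf^2 ||p||_2^2, which is the Carleson embedding for
   |f'|^2 (1 - |z|^2) and follows from f' p = (f p)' - f p'. *)

theory Submission
  imports Defs "HOL-Complex_Analysis.Conformal_Mappings"
begin

subsection \<open>Inner products and integration over the circle\<close>

text \<open>The hypothesis bounds combinations of the C_n with scalar coefficients only. Truncating
  g itself would leave a different vector behind each C_n, a sum for which the hypothesis gives no
  l2 bound; this is why the truncation has to fall on a scalar factor p. Dropping the coefficients
  of f' p of index K_n and above is harmless only if F_n / p is analytic, so p needs an analytic
  inverse. The natural choice is the outer function with |p| = |g| on the circle. A polynomial whose
  real part dominates |g| serves as well: it has no zeros in the disc, and if its value at the
  centre is real, its L2 norm is at most sqrt 2 times that of its real part. Its inverse is then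
  replaced by a polynomial too, so that only polynomials are ever multiplied and only finitely many
  Fourier coefficients occur. Replacing 1 / p, and later general g and h, by polynomials leaves
  errors proportional to sup |f'|, which is not controlled by ||f||_inf. They vanish in the limit
  because f stays fixed meanwhile, so the final constant is absolute.\<close>

instance complex_hilbert_space \<subseteq> banach ..

lemma cinner_add_right: "cinner x (y + z) = cinner x y + cinner x z"
  for x :: "'h::complex_hilbert_space"
  by (metis cinner_commute cinner_add_left complex_cnj_add)

lemma cinner_scaleC_right: "cinner x (a *\<^sub>C y) = cnj a * cinner x y"
  for x :: "'h::complex_hilbert_space"
  by (metis cinner_commute cinner_scaleC_left complex_cnj_mult)

text \<open>Rotating \<open>x\<close> by a unimodular scalar makes the inner product real and
  nonnegative, which reduces the claim to the Cauchy-Schwarz inequality of the underlying real inner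
  product.\<close>

lemma cmod_cinner_le: "cmod (cinner x y) \<le> norm x * norm y"
  for x :: "'h::complex_hilbert_space"
proof (cases "cinner x y = 0")
  case False
  define a where "a = cnj (sgn (cinner x y))"
  have a: "cmod a = 1" "a * cinner x y = cmod (cinner x y)"
    using False complex_norm_square[of "cinner x y"]
    by (auto simp: a_def norm_sgn norm_divide sgn_div_norm scaleR_conv_of_real field_simps power2_eq_square)
  have "cmod (cinner x y) = inner (a *\<^sub>C x) y"
    unfolding inner_eq_Re_cinner cinner_scaleC_left a by simp
  also have "\<dots> \<le> norm (a *\<^sub>C x) * norm y"
    by (rule norm_cauchy_schwarz)
  finally show ?thesis by (simp add: norm_scaleC a)
qed simp

interpretation cinner: bounded_bilinear "cinner :: 'h::complex_hilbert_space \<Rightarrow> _"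
  by unfold_locales
    (auto simp: cinner_add_left cinner_add_right scaleR_scaleC cinner_scaleC_left cinner_scaleC_right
      scaleR_conv_of_real cmod_cinner_le intro!: exI[of _ 1])

interpretation scaleC: bounded_bilinear "(*\<^sub>C) :: complex \<Rightarrow> 'h \<Rightarrow> 'h::complex_hilbert_space"
  by unfold_locales
    (auto simp: scaleC_add_left scaleC_add_right scaleR_scaleC_commute norm_scaleC scaleR_scaleC
      scaleC_scaleC scaleR_conv_of_real mult.commute intro!: exI[of _ 1])

lemma norm_scaleC_blinfun: "norm (a *\<^sub>C T) = cmod a * norm T"
  for T :: "'a::real_normed_vector \<Rightarrow>\<^sub>L 'h::complex_hilbert_space"
proof -
  have le: "norm (a *\<^sub>C T) \<le> cmod a * norm T" for a and T :: "'a \<Rightarrow>\<^sub>L 'h"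
    by (rule norm_blinfun_bound)
      (auto simp: scaleC_blinfun.rep_eq norm_scaleC mult.assoc intro!: mult_left_mono norm_blinfun)
  show ?thesis
  proof (cases "a = 0")
    case False
    \<comment> \<open>The inequality \<open>le\<close>, applied to \<open>inverse a\<close> and
      \<open>a *\<^sub>C T\<close>, becomes the missing lower bound.\<close>
    have "inverse a *\<^sub>C a *\<^sub>C T = T"
      by (rule blinfun_eqI) (simp add: scaleC_blinfun.rep_eq scaleC_scaleC scaleC_one False)
    with le[of "inverse a" "a *\<^sub>C T"] have "norm T \<le> norm (a *\<^sub>C T) / cmod a"
      by (simp add: norm_inverse field_simps norm_divide)
    then show ?thesis using le[of a T] False by (simp add: field_simps)
  qed (use le[of 0 T] in simp)
qed

lemma antilinear_isometryD:
  assumes "antilinear_isometry J"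
  shows "J (x + y) = J x + J y" "J (a *\<^sub>C x) = cnj a *\<^sub>C J x" "norm (J x) = norm x"
  using assms by (auto simp: antilinear_isometry_def)

lemma antilinear_isometry_bounded_linear:
  assumes "antilinear_isometry J"
  shows "bounded_linear J"
  by (rule bounded_linear_intro[where K = 1])
    (simp_all add: antilinear_isometryD[OF assms] scaleR_scaleC)

section \<open>Normalized Lebesgue measure on the circle and Fourier coefficients of
  polynomials\<close>

lemma space_circle_measure: "space circle_measure = unit_circle"
  by (simp add: circle_measure_def)

lemma cis_measurable_circle [measurable]:
  "cis \<in> uniform_measure lborel {0..2 * pi} \<rightarrow>\<^sub>M restrict_space borel unit_circle"
  by (rule measurable_restrict_space2)
    (auto simp: uniform_measure_def intro!: borel_measurable_continuous_onI continuous_intros)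

lemma borel_measurable_circle:
  "F \<in> borel_measurable borel \<Longrightarrow> F \<in> borel_measurable circle_measure"
  unfolding circle_measure_def
  by (intro measurable_completion) (simp add: measurable_restrict_space1)

lemma emeasure_circle_space: "emeasure circle_measure unit_circle = 1"
proof -
  have "cis -` unit_circle \<inter> UNIV = UNIV"
    by auto
  then have "emeasure circle_measure unit_circle = emeasure (uniform_measure lborel {0..2 * pi}) UNIV"
    using sets.top[of "restrict_space borel unit_circle"]
    unfolding circle_measure_def by (subst emeasure_completion) (auto simp: emeasure_distr)
  also have "\<dots> = 1"
    by (subst emeasure_uniform_measure) (auto simp: ennreal_divide_self)
  finally show ?thesis .
qed

interpretation circle: finite_measure circle_measure
  by (rule finite_measureI) (simp add: space_circle_measure emeasure_circle_space)

lemma measure_circle_space [simp]: "measure circle_measure unit_circle = 1"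
  by (simp add: measure_def emeasure_circle_space)

lemma continuous_on_circle_measurable:
  fixes F :: "complex \<Rightarrow> 'b::topological_space"
  assumes "continuous_on unit_circle F"
  shows "F \<in> borel_measurable circle_measure"
  unfolding circle_measure_def
  by (intro measurable_completion) (simp add: borel_measurable_continuous_on_restrict assms)

lemma continuous_on_circle_bounded:
  fixes F :: "complex \<Rightarrow> 'b::real_normed_vector"
  assumes "continuous_on unit_circle F"
  shows "\<exists>B>0. \<forall>z\<in>unit_circle. norm (F z) \<le> B"
  using compact_imp_bounded[OF compact_continuous_image[OF assms compact_sphere]]
  unfolding bounded_pos by auto

lemma integrable_circle_continuous:
  fixes F :: "complex \<Rightarrow> 'b::{banach, second_countable_topology}"
  assumes "continuous_on unit_circle F"
  shows "integrable circle_measure F"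
proof -
  obtain B where "\<forall>z\<in>unit_circle. norm (F z) \<le> B"
    using continuous_on_circle_bounded[OF assms] by auto
  then show ?thesis
    by (intro circle.integrable_const_bound[where B = B] AE_I2)
      (auto simp: space_circle_measure continuous_on_circle_measurable[OF assms])
qed

lemma integral_circle_measure:
  fixes F :: "complex \<Rightarrow> 'b::{banach, second_countable_topology}"
  assumes [measurable]: "F \<in> borel_measurable borel"
  shows "integral\<^sup>L circle_measure F = (1 / (2 * pi)) *\<^sub>R (LINT t:{0..2*pi}|lborel. F (cis t))"
proof -
  have [measurable]: "F \<in> borel_measurable (restrict_space borel unit_circle)"
    by (simp add: measurable_restrict_space1)
  have [measurable]: "cis \<in> borel_measurable borel"
    by (intro borel_measurable_continuous_onI continuous_intros)
  have "integral\<^sup>L circle_measure F = integral\<^sup>L (uniform_measure lborel {0..2*pi}) (\<lambda>t. F (cis t))"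
    unfolding circle_measure_def by (subst integral_completion) (auto simp: integral_distr)
  also have "\<dots> = (1 / (2 * pi)) *\<^sub>R (LINT t:{0..2*pi}|lborel. F (cis t))"
  proof -
    have "(\<lambda>x. indicator {0..2 * pi} x / emeasure lborel {0..2 * pi})
      = (\<lambda>x. ennreal (indicator {0..2 * pi} x / (2 * pi)))"
      by (auto simp: fun_eq_iff divide_ennreal[of 1, simplified, symmetric] indicator_def)
    then show ?thesis
      unfolding uniform_measure_def set_lebesgue_integral_def
      by (simp add: integral_density flip: integral_scaleR_right)
  qed
  finally show ?thesis .
qed

text \<open>Negative powers of \<open>z\<close> are written as powers of \<open>cnj z\<close>: both
  agree on the circle, but the latter are continuous, hence Borel, on the whole plane, as the
  passage to an integral over \<open>{0..2*pi}\<close> demands.\<close>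

lemma integral_circle_powers:
  "integral\<^sup>L circle_measure (\<lambda>z. z ^ m * cnj z ^ k) = (if m = k then 1 else 0)"
proof -
  define n :: real where "n = real m - real k"
  have eq: "cis t ^ m * cnj (cis t) ^ k = cis (n * t)" for t
    by (simp add: Complex.DeMoivre cis_cnj cis_mult n_def algebra_simps)
  have "integral\<^sup>L circle_measure (\<lambda>z. z ^ m * cnj z ^ k)
      = (1 / (2 * pi)) *\<^sub>R (LINT t:{0..2*pi}|lborel. cis (n * t))"
    by (subst integral_circle_measure)
      (auto simp: eq intro!: borel_measurable_continuous_onI continuous_intros)
  also have "\<dots> = (if m = k then 1 else 0)"
  proof (cases "m = k")
    case True
    then show ?thesis
      by (simp add: n_def set_lebesgue_integral_def scaleR_conv_of_real)
  next
    case False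
    then have n: "n \<noteq> 0" by (simp add: n_def)
    have "(LINT t:{0..2*pi}|lborel. cis (n * t))
        = cis (n * (2 * pi)) / (\<i> * n) - cis (n * 0) / (\<i> * n)"
      unfolding set_lebesgue_integral_def
    proof (rule integral_FTC_Icc)
      fix x
      show "((\<lambda>t. cis (n * t) / (\<i> * n)) has_vector_derivative cis (n * x)) (at x within {0..2 * pi})"
        using n unfolding cis_conv_exp
        by (auto intro!: derivative_eq_intros has_vector_derivative_real_field simp: field_simps)
    qed (auto intro!: continuous_intros)
    also have "cis (n * (2 * pi)) = cis (2 * pi * of_int (int m - int k))"
      by (simp add: n_def mult_ac)
    also have "\<dots> = 1" by (rule cis_multiple_2pi) auto
    finally show ?thesis using False by simp
  qed
  finally show ?thesis .
qed

lemma integral_circle_cnj_power_poly: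
  "integral\<^sup>L circle_measure (\<lambda>z. cnj z ^ m * poly p z) = coeff p m"
proof -
  have "integral\<^sup>L circle_measure (\<lambda>z. cnj z ^ m * poly p z)
      = integral\<^sup>L circle_measure (\<lambda>z. \<Sum>i\<le>degree p. coeff p i * (z ^ i * cnj z ^ m))"
    by (simp add: poly_altdef sum_distrib_left mult_ac)
  also have "\<dots> = (\<Sum>i\<le>degree p. coeff p i * (if i = m then 1 else 0))"
    by (subst Bochner_Integration.integral_sum)
      (auto simp: integral_circle_powers intro!: integrable_circle_continuous continuous_intros)
  also have "\<dots> = coeff p m"
    by (auto simp: if_distrib[of "\<lambda>x. _ * x"] sum.delta coeff_eq_0 cong: if_cong)
  finally show ?thesis .
qed

lemma parseval_poly:
  "integral\<^sup>L circle_measure (\<lambda>z. (cmod (poly p z))\<^sup>2) = (\<Sum>k\<le>degree p. (cmod (coeff p k))\<^sup>2)"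
proof -
  have "complex_of_real (integral\<^sup>L circle_measure (\<lambda>z. (cmod (poly p z))\<^sup>2))
      = integral\<^sup>L circle_measure (\<lambda>z. \<Sum>k\<le>degree p. cnj (coeff p k) * (cnj z ^ k * poly p z))"
    unfolding integral_complex_of_real[symmetric] complex_norm_square
    by (subst (2) poly_altdef) (simp add: sum_distrib_left mult_ac)
  also have "\<dots> = (\<Sum>k\<le>degree p. cnj (coeff p k) * coeff p k)"
    by (subst Bochner_Integration.integral_sum)
      (auto simp: integral_circle_cnj_power_poly intro!: integrable_circle_continuous continuous_intros)
  also have "\<dots> = complex_of_real (\<Sum>k\<le>degree p. (cmod (coeff p k))\<^sup>2)"
    unfolding of_real_sum complex_norm_square by (simp add: mult.commute)
  finally show ?thesis unfolding of_real_eq_iff .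
qed

lemma fourier_coeff_poly: "fourier_coeff (poly p) (int k) = coeff p k"
proof -
  have "z powi (- int k) = cnj z ^ k" if "z \<in> unit_circle" for z
    using that complex_norm_square[of z]
    by (simp add: power_int_minus power_inverse[symmetric] inverse_unique)
  then have "fourier_coeff (poly p) (int k) = integral\<^sup>L circle_measure (\<lambda>z. cnj z ^ k * poly p z)"
    unfolding fourier_coeff_def
    by (intro Bochner_Integration.integral_cong) (auto simp: space_circle_measure)
  then show ?thesis by (simp add: integral_circle_cnj_power_poly)
qed

lemma poly_in_disc_algebra: "poly p \<in> disc_algebra"
  unfolding disc_algebra_def by (auto intro!: continuous_intros exI[of _ p])

subsection \<open>Density of trigonometric polynomials in \<open>L\<^sup>2\<close>\<close>

lemma integrable_mult_of_squares:
  fixes a b :: "'a \<Rightarrow> real"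
  assumes [measurable]: "a \<in> borel_measurable M" "b \<in> borel_measurable M"
    and "integrable M (\<lambda>x. (a x)\<^sup>2)" "integrable M (\<lambda>x. (b x)\<^sup>2)"
  shows "integrable M (\<lambda>x. a x * b x)"
proof (rule Bochner_Integration.integrable_bound)
  show "integrable M (\<lambda>x. (a x)\<^sup>2 + (b x)\<^sup>2)" using assms by simp
  show "AE x in M. norm (a x * b x) \<le> norm ((a x)\<^sup>2 + (b x)\<^sup>2)"
  proof (rule AE_I2)
    fix x
    have "2 * (\<bar>a x\<bar> * \<bar>b x\<bar>) \<le> (a x)\<^sup>2 + (b x)\<^sup>2"
      using sum_squares_bound[of "\<bar>a x\<bar>" "\<bar>b x\<bar>"] by (simp add: mult.assoc)
    moreover have "0 \<le> \<bar>a x\<bar> * \<bar>b x\<bar>" by simp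
    ultimately show "norm (a x * b x) \<le> norm ((a x)\<^sup>2 + (b x)\<^sup>2)"
      unfolding real_norm_def abs_mult by linarith
  qed
qed measurable

text \<open>The integral of \<open>(t * a x - b x)^2\<close> is a nonnegative quadratic polynomial
  in \<open>t\<close>; its value at the minimiser \<open>X / A\<close> is the claim.\<close>

lemma integral_Cauchy_Schwarz:
  fixes a b :: "'a \<Rightarrow> real"
  assumes [measurable]: "a \<in> borel_measurable M" "b \<in> borel_measurable M"
    and int: "integrable M (\<lambda>x. (a x)\<^sup>2)" "integrable M (\<lambda>x. (b x)\<^sup>2)"
  shows "(\<integral>x. a x * b x \<partial>M) \<le> sqrt (\<integral>x. (a x)\<^sup>2 \<partial>M) * sqrt (\<integral>x. (b x)\<^sup>2 \<partial>M)"
proof -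
  define A where "A = (\<integral>x. (a x)\<^sup>2 \<partial>M)"
  define B where "B = (\<integral>x. (b x)\<^sup>2 \<partial>M)"
  define X where "X = (\<integral>x. a x * b x \<partial>M)"
  have iab: "integrable M (\<lambda>x. a x * b x)"
    by (rule integrable_mult_of_squares) (use int in auto)
  have A: "A \<ge> 0" unfolding A_def by simp
  have B: "B \<ge> 0" unfolding B_def by simp
  have quad: "0 \<le> t\<^sup>2 * A - 2 * t * X + B" for t
  proof -
    have "0 \<le> (\<integral>x. (t * a x - b x)\<^sup>2 \<partial>M)" by simp
    also have "\<dots> = (\<integral>x. t\<^sup>2 * (a x)\<^sup>2 - 2 * t * (a x * b x) + (b x)\<^sup>2 \<partial>M)"
      by (rule Bochner_Integration.integral_cong) (auto simp: power2_eq_square algebra_simps)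
    also have "\<dots> = t\<^sup>2 * A - 2 * t * X + B"
      unfolding A_def B_def X_def
      using int iab by simp
    finally show ?thesis .
  qed
  have "X\<^sup>2 \<le> A * B"
  proof (cases "A = 0")
    case True
    have "X = 0"
    proof (rule ccontr)
      assume "X \<noteq> 0"
      \<comment> \<open>For \<open>A = 0\<close> the quadratic is the linear function
        \<open>B - 2 * t * X\<close>, and this \<open>t\<close> gives it the value -1.\<close>
      with quad[of "(B + 1) / (2 * X)"] True show False by simp
    qed
    then show ?thesis using True by simp
  next
    case False
    with quad[of "X / A"] A show ?thesis
      by (simp add: field_simps power2_eq_square)
  qed
  then have "X \<le> sqrt (A * B)" by (rule real_le_rsqrt)
  then show ?thesis by (simp add: A_def B_def X_def real_sqrt_mult)
qed

text \<open>A triangle inequality that stays with squared norms, so that L2 errors can be chained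
  without Minkowski's inequality; each use costs a factor 2.\<close>

lemma norm_diff_sq_le:
  fixes x y z :: "'a::real_normed_vector"
  shows "(norm (x - z))\<^sup>2 \<le> 2 * (norm (x - y))\<^sup>2 + 2 * (norm (y - z))\<^sup>2"
proof -
  have "norm (x - z) \<le> norm (x - y) + norm (y - z)"
    using norm_triangle_ineq[of "x - y" "y - z"] by simp
  then have "(norm (x - z))\<^sup>2 \<le> (norm (x - y) + norm (y - z))\<^sup>2"
    by (intro power_mono) auto
  also have "\<dots> \<le> 2 * (norm (x - y))\<^sup>2 + 2 * (norm (y - z))\<^sup>2"
    using sum_squares_bound[of "norm (x - y)" "norm (y - z)"] by (simp add: power2_sum)
  finally show ?thesis .
qed

lemma norm_sum_sq_le:
  fixes f :: "'b \<Rightarrow> 'a::real_normed_vector"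
  shows "(norm (\<Sum>i\<in>I. f i))\<^sup>2 \<le> card I * (\<Sum>i\<in>I. (norm (f i))\<^sup>2)"
proof -
  have "(norm (\<Sum>i\<in>I. f i))\<^sup>2 \<le> (\<Sum>i\<in>I. 1 * norm (f i))\<^sup>2"
    by (intro power_mono) (auto intro: norm_sum)
  also have "\<dots> \<le> (\<Sum>i\<in>I. 1\<^sup>2) * (\<Sum>i\<in>I. (norm (f i))\<^sup>2)"
    by (rule Cauchy_Schwarz_ineq_sum)
  finally show ?thesis by simp
qed

text \<open>For nonseparable \<open>H\<close> the Borel sets of a product may exceed the product
  sigma-algebra, so Borel measurability of two functions says little about a combination of them.
  Their simple approximants, in contrast, are mapped by \<open>G\<close> to simple functions
  again.\<close>

lemma strongly_measurable_compose2:
  fixes f :: "'a \<Rightarrow> 'b::metric_space" and g :: "'a \<Rightarrow> 'c::metric_space"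
    and G :: "'b \<Rightarrow> 'c \<Rightarrow> 'd::metric_space"
  assumes "strongly_measurable M f" "strongly_measurable M g"
    and G: "continuous_on UNIV (\<lambda>(x, y). G x y)"
  shows "strongly_measurable M (\<lambda>x. G (f x) (g x))"
proof -
  obtain s t where s: "\<And>n. simple_function M (s n)" "AE x in M. (\<lambda>n. s n x) \<longlonglongrightarrow> f x"
    and t: "\<And>n. simple_function M (t n)" "AE x in M. (\<lambda>n. t n x) \<longlonglongrightarrow> g x"
    using assms by (auto simp: strongly_measurable_def)
  have "AE x in M. (\<lambda>n. G (s n x) (t n x)) \<longlonglongrightarrow> G (f x) (g x)"
    using s(2) t(2)
  proof eventually_elim
    case (elim x)
    have "isCont (\<lambda>(x, y). G x y) (f x, g x)"
      using G by (simp add: continuous_on_eq_continuous_at)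
    from isCont_tendsto_compose[OF this tendsto_Pair[OF elim]] show ?case by simp
  qed
  moreover have "simple_function M (\<lambda>x. G (s n x) (t n x))" for n
    by (rule simple_function_compose2[OF s(1) t(1)])
  ultimately show ?thesis
    unfolding strongly_measurable_def by (intro exI[of _ "\<lambda>n x. G (s n x) (t n x)"] conjI allI)
qed

lemma strongly_measurable_compose:
  fixes f :: "'a \<Rightarrow> 'b::metric_space" and G :: "'b \<Rightarrow> 'c::metric_space"
  assumes "strongly_measurable M f" "continuous_on UNIV G"
  shows "strongly_measurable M (\<lambda>x. G (f x))"
proof (rule strongly_measurable_compose2[OF assms(1,1), of "\<lambda>x y. G x"])
  show "continuous_on UNIV (\<lambda>(x, y). G x)"
    unfolding case_prod_beta by (rule continuous_on_compose2[OF assms(2)]) (auto intro: continuous_intros)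
qed

lemma strongly_measurable_borel:
  fixes f :: "'a \<Rightarrow> 'b::{metric_space, second_countable_topology}"
  assumes "f \<in> borel_measurable M"
  shows "strongly_measurable M f"
proof -
  obtain s where "\<And>i. simple_function M (s i)" "\<And>x. x \<in> space M \<Longrightarrow> (\<lambda>i. s i x) \<longlonglongrightarrow> f x"
    using borel_measurable_implies_sequence_metric[OF assms, of undefined] by blast
  then show ?thesis
    unfolding strongly_measurable_def by (intro exI[of _ s] conjI allI AE_I2)
qed

text \<open>The preimages under \<open>f\<close> and \<open>g\<close> differ by a subset of a null
  set, which completeness makes measurable. Limits that exist only almost everywhere therefore
  preserve measurability on the circle.\<close>

lemma (in complete_measure) borel_measurable_AE_eq:
  fixes f g :: "'a \<Rightarrow> 'b::topological_space"
  assumes f: "f \<in> borel_measurable M" and ae: "AE x in M. f x = g x"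
  shows "g \<in> borel_measurable M"
proof (rule measurableI)
  fix A :: "'b set" assume A: "A \<in> sets borel"
  show "g -` A \<inter> space M \<in> sets M"
  proof (rule in_sets_AE)
    show "AE x in M. x \<in> f -` A \<inter> space M \<longleftrightarrow> x \<in> g -` A \<inter> space M"
      using ae by eventually_elim auto
  qed (use f A in auto)
qed auto

lemma (in complete_measure) strongly_measurable_imp_borel:
  fixes f :: "'a \<Rightarrow> 'b::{banach, second_countable_topology}"
  assumes "strongly_measurable M f"
  shows "f \<in> borel_measurable M"
proof -
  obtain s where s: "\<And>n. simple_function M (s n)" "AE x in M. (\<lambda>n. s n x) \<longlonglongrightarrow> f x"
    using assms by (auto simp: strongly_measurable_def)
  have "(\<lambda>x. lim (\<lambda>n. s n x)) \<in> borel_measurable M"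
    by (rule borel_measurable_lim_metric) (rule borel_measurable_simple_function[OF s(1)])
  moreover have "AE x in M. lim (\<lambda>n. s n x) = f x"
    using s(2) by eventually_elim (rule limI)
  ultimately show ?thesis by (rule borel_measurable_AE_eq)
qed

lemma strongly_measurable_circle_borel:
  fixes f :: "complex \<Rightarrow> 'b::{banach, second_countable_topology}"
  assumes "strongly_measurable circle_measure f"
  shows "f \<in> borel_measurable circle_measure"
  using completion.strongly_measurable_imp_borel assms unfolding circle_measure_def by blast

lemma strongly_measurable_circle_continuous:
  fixes G :: "complex \<Rightarrow> 'c::metric_space"
  assumes "continuous_on UNIV G"
  shows "strongly_measurable circle_measure G"
proof (rule strongly_measurable_compose[OF _ assms, of _ "\<lambda>z. z"])
  show "strongly_measurable circle_measure (\<lambda>z. z)"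
    by (intro strongly_measurable_borel continuous_on_circle_measurable continuous_intros)
qed

text \<open>Splitting off constant terms, \<open>p = a + z p'\<close> and
  \<open>q = b + z q'\<close>, the product of the two remainders is \<open>p' * cnj q'\<close>
  because \<open>z * cnj z = 1\<close>; this drives the recursion. The mixed term containing
  \<open>cnj q'\<close> may be conjugated, since only its real part counts.\<close>

lemma Re_poly_mult_cnj: "\<exists>r. \<forall>z\<in>unit_circle. Re (poly p z * cnj (poly q z)) = Re (poly r z)"
proof (induction p arbitrary: q)
  case 0
  show ?case by (rule exI[of _ 0]) simp
next
  case (pCons a p)
  obtain b q' where q: "q = pCons b q'" by (cases q)
  obtain r where r: "\<forall>z\<in>unit_circle. Re (poly p z * cnj (poly q' z)) = Re (poly r z)"
    using pCons.IH by blast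
  show ?case
  proof (intro exI ballI)
    fix z assume z: "z \<in> unit_circle"
    then have zz: "z * cnj z = 1" using complex_norm_square[of z] by simp
    have "poly (pCons a p) z * cnj (poly q z)
        = a * cnj b + a * cnj (z * poly q' z) + cnj b * (z * poly p z)
          + (z * cnj z) * (poly p z * cnj (poly q' z))"
      by (simp add: q algebra_simps)
    then have "Re (poly (pCons a p) z * cnj (poly q z))
        = Re (a * cnj b) + Re (a * cnj (z * poly q' z)) + Re (cnj b * (z * poly p z))
          + Re (poly p z * cnj (poly q' z))"
      by (simp only: zz plus_complex.sel mult_1)
    also have "Re (a * cnj (z * poly q' z)) = Re (cnj (a * cnj (z * poly q' z)))"
      by (simp only: cnj.sel)
    also have "cnj (a * cnj (z * poly q' z)) = cnj a * (z * poly q' z)" by simp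
    also have "Re (poly p z * cnj (poly q' z)) = Re (poly r z)" using r z by blast
    finally show "Re (poly (pCons a p) z * cnj (poly q z))
      = Re (poly ([:a * cnj b:] + smult (cnj a) (pCons 0 q') + smult (cnj b) (pCons 0 p) + r) z)"
      by (simp only: poly_add poly_smult poly_pCons plus_complex.sel mult_zero_left mult_zero_right
          poly_0 add_0_left add_0_right)
  qed
qed

text \<open>Real parts of polynomials form an algebra on the circle, by
  \<open>2 * Re u * Re w = Re (u * w) + Re (u * cnj w)\<close>, and \<open>Re z\<close> and
  \<open>Re (-i z)\<close> separate points. The result serves twice: for the density of
  trigonometric polynomials and for finding a polynomial with almost prescribed real part in
  \<open>outer_approx\<close>.\<close>

lemma Re_poly_dense_circle:
  assumes v: "continuous_on unit_circle v" and e: "e > 0"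
  shows "\<exists>p. \<forall>z\<in>unit_circle. \<bar>v z - Re (poly p z)\<bar> < e"
proof -
  define P where "P f \<longleftrightarrow> (\<exists>p. \<forall>z\<in>unit_circle. f z = Re (poly p z))" for f
  have "\<exists>g. P g \<and> (\<forall>z\<in>unit_circle. \<bar>v z - g z\<bar> < e)"
  proof (rule Stone_Weierstrass_HOL[where P = P])
    show "P (\<lambda>x. c)" for c
      unfolding P_def by (rule exI[of _ "[:of_real c:]"]) simp
    show "continuous_on unit_circle f" if "P f" for f
    proof -
      obtain p where "\<forall>z\<in>unit_circle. f z = Re (poly p z)" using \<open>P f\<close> by (auto simp: P_def)
      then show ?thesis
        by (subst continuous_on_cong[OF refl, of _ _ "\<lambda>z. Re (poly p z)"]) (auto intro!: continuous_intros)
    qed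
    show "P (\<lambda>x. f x + g x)" if "P f \<and> P g" for f g
      using that unfolding P_def
    proof safe
      fix p q assume "\<forall>z\<in>unit_circle. f z = Re (poly p z)" "\<forall>z\<in>unit_circle. g z = Re (poly q z)"
      then show "\<exists>p. \<forall>z\<in>unit_circle. f z + g z = Re (poly p z)"
        by (intro exI[of _ "p + q"]) simp
    qed
    show "P (\<lambda>x. f x * g x)" if "P f \<and> P g" for f g
      using that unfolding P_def
    proof safe
      fix p q assume pq: "\<forall>z\<in>unit_circle. f z = Re (poly p z)" "\<forall>z\<in>unit_circle. g z = Re (poly q z)"
      obtain r where r: "\<forall>z\<in>unit_circle. Re (poly p z * cnj (poly q z)) = Re (poly r z)"
        using Re_poly_mult_cnj by blast
      have "f z * g z = Re (poly (smult (1/2) (p * q + r)) z)" if "z \<in> unit_circle" for z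
        using that pq r[rule_format, OF that, symmetric] by (simp add: field_simps)
      then show "\<exists>p. \<forall>z\<in>unit_circle. f z * g z = Re (poly p z)" by blast
    qed
    show "\<exists>f. P f \<and> f x \<noteq> f y" if "x \<in> unit_circle \<and> y \<in> unit_circle \<and> x \<noteq> y" for x y
    proof (cases "Re x = Re y")
      case False
      then show ?thesis
        by (intro exI[of _ Re] conjI) (auto simp: P_def intro!: exI[of _ "[:0, 1:]"])
    next
      case True
      with that have "Im x \<noteq> Im y" by (auto simp: complex_eq_iff)
      then show ?thesis
        by (intro exI[of _ Im] conjI) (auto simp: P_def intro!: exI[of _ "[:0, -\<i>:]"])
    qed
  qed (use v e in auto)
  then show ?thesis unfolding P_def by fastforce
qed

text \<open>The extra factor \<open>cnj z\<close> keeps frequency 0 out of the second summand, so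
  that \<open>p\<close> is exactly the projection onto the nonnegative frequencies.\<close>

definition trig_poly :: "complex poly \<Rightarrow> complex poly \<Rightarrow> complex \<Rightarrow> complex" where
  "trig_poly p q z = poly p z + cnj z * poly q (cnj z)"

lemma continuous_on_trig_poly [continuous_intros]: "continuous_on A (trig_poly p q)"
  unfolding trig_poly_def by (intro continuous_intros)

lemma Re_poly_eq_trig_poly: "\<exists>p' q. \<forall>z. complex_of_real (Re (poly p z)) = trig_poly p' q z"
proof -
  obtain a r where p: "p = pCons a r" by (cases p)
  \<comment> \<open>In \<open>(p + cnj p) / 2\<close> the conjugated constant coefficient has
    frequency 0 and therefore joins the analytic part.\<close>
  have "complex_of_real (Re (poly p z))
      = trig_poly (smult (1/2) (p + [:cnj a:])) (smult (1/2) (map_poly cnj r)) z" for z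
  proof -
    have "complex_of_real (Re (poly p z)) = (poly p z + cnj (poly p z)) / 2"
      unfolding complex_add_cnj by simp
    also have "\<dots> = trig_poly (smult (1/2) (p + [:cnj a:])) (smult (1/2) (map_poly cnj r)) z"
      by (simp add: trig_poly_def p add_divide_distrib)
    finally show ?thesis .
  qed
  then show ?thesis by blast
qed

lemma indicator_compact_approx:
  fixes K :: "complex set"
  assumes "compact K" "e > 0"
  shows "\<exists>v. continuous_on UNIV v \<and> (\<integral>z. (indicator K z - v z :: real)\<^sup>2 \<partial>circle_measure) < e"
proof (cases "K = {}")
  \<comment> \<open>The empty set is treated apart because \<open>infdist z {}\<close> is 0, which
    would turn the functions \<open>v n\<close> below into the constant 1.\<close>
  case True
  then show ?thesis using assms by (intro exI[of _ "\<lambda>_. 0"]) simp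
next
  case False
  define v where "v n z = max 0 (1 - real n * infdist z K)" for n z
  have cont: "continuous_on A (v n)" for n A
    unfolding v_def by (intro continuous_intros)
  have [measurable]: "K \<in> sets borel" using assms by (simp add: borel_compact)
  have [measurable]: "(\<lambda>z. indicator K z :: real) \<in> borel_measurable circle_measure"
    by (intro borel_measurable_circle) measurable
  have [measurable]: "v n \<in> borel_measurable circle_measure" for n
    by (rule continuous_on_circle_measurable[OF cont])
  have v01: "0 \<le> v n z" "v n z \<le> 1" for n z
    by (auto simp: v_def infdist_nonneg)
  have "(\<lambda>n. \<integral>z. (indicator K z - v n z)\<^sup>2 \<partial>circle_measure) \<longlonglongrightarrow> (\<integral>z. 0 \<partial>circle_measure)"
  proof (rule integral_dominated_convergence[where w = "\<lambda>_. 1"])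
    show "AE z in circle_measure. (\<lambda>n. (indicator K z - v n z)\<^sup>2) \<longlonglongrightarrow> 0"
    proof (rule AE_I2)
      fix z
      show "(\<lambda>n. (indicator K z - v n z)\<^sup>2) \<longlonglongrightarrow> 0"
      proof (cases "z \<in> K")
        case True
        then show ?thesis by (simp add: v_def)
      next
        case zK: False
        then have d: "infdist z K > 0"
          using infdist_pos_not_in_closed[of K z] False assms compact_imp_closed by auto
        obtain N :: nat where N: "1 / infdist z K \<le> real N" using real_arch_simple by blast
        have "v n z = 0" if "n \<ge> N" for n
        proof -
          have "1 / infdist z K \<le> real n" using N that by simp
          then have "1 \<le> real n * infdist z K" using d by (simp add: field_simps)
          then show ?thesis by (simp add: v_def)
        qed
        then have "\<forall>\<^sub>F n in sequentially. (indicator K z - v n z)\<^sup>2 = 0"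
          using zK by (auto simp: eventually_sequentially)
        then show ?thesis by (rule tendsto_eventually)
      qed
    qed
    show "AE z in circle_measure. norm ((indicator K z - v n z)\<^sup>2) \<le> 1" for n
    proof (rule AE_I2)
      fix z
      have "\<bar>indicator K z - v n z\<bar> \<le> 1"
        using v01[of n z] by (auto simp: indicator_def)
      then show "norm ((indicator K z - v n z)\<^sup>2) \<le> 1"
        by (simp add: abs_square_le_1)
    qed
  qed auto
  then have "\<forall>\<^sub>F n in sequentially. (\<integral>z. (indicator K z - v n z)\<^sup>2 \<partial>circle_measure) < e"
    using assms by (intro order_tendstoD(2)) auto
  then obtain n where "(\<integral>z. (indicator K z - v n z)\<^sup>2 \<partial>circle_measure) < e"
    by (auto simp: eventually_sequentially)
  then show ?thesis using cont by blast
qed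

text \<open>Inner regularity is a property of Borel measures on a Polish space. Hence the
  push-forward \<open>N\<close> to the whole plane, which agrees with \<open>circle_measure\<close>
  on Borel subsets of the circle; a set of the completion exceeds a Borel set \<open>S\<close> only
  by part of a null set, and the compact set is taken inside \<open>S\<close>.\<close>

lemma circle_sets_inner_regular:
  assumes "A \<in> sets circle_measure" "e > 0"
  shows "\<exists>K. compact K \<and> K \<subseteq> A \<and> measure circle_measure (A - K) < e"
proof -
  define U where "U = uniform_measure lborel {0..2 * pi}"
  define R where "R = distr U (restrict_space borel unit_circle) cis"
  define N where "N = distr U borel cis"
  have M: "circle_measure = completion R" by (simp add: circle_measure_def R_def U_def)
  have [measurable]: "cis \<in> U \<rightarrow>\<^sub>M restrict_space borel unit_circle"
    by (simp add: U_def)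
  have [measurable]: "cis \<in> borel_measurable U"
    by (auto simp: U_def uniform_measure_def intro!: borel_measurable_continuous_onI continuous_intros)
  have restr: "B \<in> sets R \<longleftrightarrow> B \<in> sets borel \<and> B \<subseteq> unit_circle" for B
    unfolding R_def sets_distr by (subst sets_restrict_space_iff) auto
  have NR: "emeasure N B = emeasure circle_measure B" if "B \<in> sets R" for B
  proof -
    have "emeasure circle_measure B = emeasure R B"
      unfolding M using that by (subst emeasure_completion) auto
    also have "\<dots> = emeasure U (cis -` B \<inter> space U)"
      using that unfolding R_def by (subst emeasure_distr) auto
    also have "\<dots> = emeasure N B"
      using that restr unfolding N_def by (subst emeasure_distr) auto
    finally show ?thesis by simp
  qed
  obtain S N0 N' where A: "A = S \<union> N0" "N0 \<subseteq> N'" "N' \<in> null_sets R" "S \<in> sets R"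
    using assms(1) unfolding M by (elim sets_completionE) auto
  have SM: "S \<in> sets circle_measure" using A by (simp add: M)
  have S: "S \<in> sets borel" using A restr by auto
  have "emeasure N S < top"
    using NR[OF A(4)] circle.emeasure_finite[of S] by (simp add: less_top[symmetric])
  moreover have "emeasure N (space N) \<noteq> \<infinity>"
  proof -
    have "emeasure N (space N) = emeasure U UNIV"
      by (simp add: N_def emeasure_distr) (simp add: U_def)
    also have "\<dots> = 1"
      unfolding U_def by (subst emeasure_uniform_measure) (auto simp: ennreal_divide_self)
    finally show ?thesis by simp
  qed
  ultimately have SUP: "emeasure N S = (SUP K\<in>{K. K \<subseteq> S \<and> compact K}. emeasure N K)"
    by (intro inner_regular) (auto simp: N_def S)
  have "{K. K \<subseteq> S \<and> compact K} \<noteq> {}"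
    using compact_empty by blast
  moreover have "emeasure N S \<noteq> \<infinity>"
    using \<open>emeasure N S < top\<close> by simp
  ultimately have "\<exists>K\<in>{K. K \<subseteq> S \<and> compact K}. emeasure N S < emeasure N K + ennreal e"
    using SUP_approx_ennreal[OF assms(2) _ SUP] by blast
  then obtain K where K: "compact K" "K \<subseteq> S" "emeasure N S < emeasure N K + ennreal e"
    by blast
  have KR: "K \<in> sets R" using K A(4) restr borel_compact by blast
  then have KM: "K \<in> sets circle_measure" by (simp add: M)
  have "ennreal (measure circle_measure S) < ennreal (measure circle_measure K) + ennreal e"
    using K(3) NR[OF KR] NR[OF A(4)] by (simp add: circle.emeasure_eq_measure)
  then have "measure circle_measure S < measure circle_measure K + e"
    using assms(2) by (simp add: ennreal_less_iff flip: ennreal_plus)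
  moreover have "measure circle_measure (A - K) \<le> measure circle_measure (S - K)"
  proof -
    have N': "N' \<in> null_sets circle_measure" using A(3) unfolding M by (rule null_sets_completionI)
    have "measure circle_measure (A - K) \<le> measure circle_measure ((S - K) \<union> N')"
      by (rule circle.finite_measure_mono) (use A SM KM N' in auto)
    also have "\<dots> = measure circle_measure (S - K)"
      by (rule measure_Un_null_set) (use SM KM N' in auto)
    finally show ?thesis .
  qed
  moreover have "measure circle_measure (S - K) = measure circle_measure S - measure circle_measure K"
    by (rule circle.finite_measure_Diff) (use SM KM K in auto)
  ultimately show ?thesis using K A by (intro exI[of _ K]) auto
qed

lemma trig_poly_dense_continuous:
  assumes v: "continuous_on unit_circle v" and e: "e > 0"
  shows "\<exists>p q. \<forall>z\<in>unit_circle. cmod (complex_of_real (v z) - trig_poly p q z) < e"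
proof -
  obtain r where r: "\<forall>z\<in>unit_circle. \<bar>v z - Re (poly r z)\<bar> < e"
    using Re_poly_dense_circle[OF v e] by blast
  obtain p q where pq: "\<forall>z. complex_of_real (Re (poly r z)) = trig_poly p q z"
    using Re_poly_eq_trig_poly by blast
  have "cmod (complex_of_real (v z) - trig_poly p q z) < e" if "z \<in> unit_circle" for z
    using r that unfolding pq[rule_format, symmetric]
    by (simp only: of_real_diff[symmetric] norm_of_real)
  then show ?thesis by blast
qed

text \<open>Three approximations in turn: \<open>A\<close> by a compact subset in measure, the
  indicator of the latter by a continuous function in L2, and that function uniformly by a
  trigonometric polynomial.\<close>

lemma trig_poly_dense_indicator:
  assumes A: "A \<in> sets circle_measure" and e: "e > 0"
  shows "\<exists>p q. (\<integral>z. (cmod (indicator A z - trig_poly p q z))\<^sup>2 \<partial>circle_measure) < e"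
proof -
  obtain K where K: "compact K" "K \<subseteq> A" "measure circle_measure (A - K) < e / 16"
    using circle_sets_inner_regular[OF A, of "e / 16"] e by auto
  obtain v where v: "continuous_on UNIV v" "(\<integral>z. (indicator K z - v z :: real)\<^sup>2 \<partial>circle_measure) < e / 16"
    using indicator_compact_approx[OF K(1), of "e / 16"] e by auto
  obtain p q where pq: "\<forall>z\<in>unit_circle. cmod (complex_of_real (v z) - trig_poly p q z) < sqrt (e / 16)"
    using trig_poly_dense_continuous[of v "sqrt (e / 16)"] continuous_on_subset[OF v(1)] e by auto
  define t where "t = trig_poly p q"
  have "A \<subseteq> unit_circle" using sets.sets_into_space[OF A] by (simp add: space_circle_measure)
  then have "K \<in> sets circle_measure"
    using K unfolding circle_measure_def
    by (intro sets_completionI_sets) (simp add: sets_restrict_space_iff borel_compact)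
  note [measurable] = A this
  have [measurable]: "v \<in> borel_measurable circle_measure" "t \<in> borel_measurable circle_measure"
    unfolding t_def
    by (auto intro!: continuous_on_circle_measurable continuous_intros continuous_on_subset[OF v(1)])
  obtain B where "\<forall>z\<in>unit_circle. norm (v z) \<le> B"
    using continuous_on_circle_bounded[OF continuous_on_subset[OF v(1)]] by auto
  then have B: "\<And>z. z \<in> unit_circle \<Longrightarrow> \<bar>v z\<bar> \<le> B" by simp
  \<comment> \<open>Applying \<open>norm_diff_sq_le\<close> twice gives the weights 2, 4 and 4; with
    all three errors below \<open>e / 16\<close> the total is at most
    \<open>5 * e / 8\<close>.\<close>
  have sq: "(cmod (indicator A z - t z))\<^sup>2
      \<le> 2 * indicator (A - K) z + 4 * (indicator K z - v z)\<^sup>2 + e / 4" if z: "z \<in> unit_circle" for z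
  proof -
    have "(cmod (indicator A z - t z))\<^sup>2 \<le> 2 * (cmod (indicator A z - indicator K z))\<^sup>2
      + 2 * (cmod (indicator K z - t z))\<^sup>2" by (rule norm_diff_sq_le)
    also have "(cmod (indicator A z - indicator K z))\<^sup>2 = indicator (A - K) z"
      using K(2) by (auto simp: indicator_def)
    also have "(cmod (indicator K z - t z))\<^sup>2 \<le> 2 * (cmod (indicator K z - complex_of_real (v z)))\<^sup>2
      + 2 * (cmod (complex_of_real (v z) - t z))\<^sup>2" by (rule norm_diff_sq_le)
    also have "cmod (indicator K z - complex_of_real (v z)) = \<bar>indicator K z - v z\<bar>"
      unfolding norm_of_real[symmetric, where 'a = complex] by (auto simp: indicator_def)
    also have "(cmod (complex_of_real (v z) - t z))\<^sup>2 \<le> (sqrt (e / 16))\<^sup>2"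
      unfolding t_def by (rule power_mono[OF less_imp_le[OF pq[rule_format, OF z]]]) simp
    finally show ?thesis using e by simp
  qed
  have ivK: "integrable circle_measure (\<lambda>z. (indicator K z - v z)\<^sup>2)"
  proof (rule circle.integrable_const_bound[where B = "(1 + B)\<^sup>2"])
    show "AE z in circle_measure. norm ((indicator K z - v z)\<^sup>2) \<le> (1 + B)\<^sup>2"
    proof (rule AE_I2)
      fix z assume "z \<in> space circle_measure"
      then have "\<bar>indicator K z - v z\<bar> \<le> 1 + B"
        using B[of z] by (auto simp: space_circle_measure indicator_def)
      then show "norm ((indicator K z - v z)\<^sup>2) \<le> (1 + B)\<^sup>2"
        using power_mono[of "\<bar>indicator K z - v z\<bar>" "1 + B" 2] by simp
    qed
  qed measurable
  have irhs: "integrable circle_measure (\<lambda>z. 2 * indicator (A - K) z + 4 * (indicator K z - v z)\<^sup>2 + e / 4)"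
    by (intro Bochner_Integration.integrable_add integrable_mult_right ivK) (auto simp: less_top[symmetric])
  have "(\<integral>z. (cmod (indicator A z - t z))\<^sup>2 \<partial>circle_measure)
      \<le> (\<integral>z. 2 * indicator (A - K) z + 4 * (indicator K z - v z)\<^sup>2 + e / 4 \<partial>circle_measure)"
    using irhs
    by (rule integral_mono_AE')
      (auto intro!: AE_I2 sq order_trans[OF zero_le_power2 sq] simp: space_circle_measure)
  also have "\<dots> = 2 * measure circle_measure (A - K)
      + 4 * (\<integral>z. (indicator K z - v z)\<^sup>2 \<partial>circle_measure) + e / 4"
  proof -
    have "integrable circle_measure (\<lambda>z. indicator (A - K) z :: real)"
      by (rule integrable_real_indicator) (auto simp: less_top[symmetric])
    moreover have "(A - K) \<inter> unit_circle = A - K"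
      using \<open>A \<subseteq> unit_circle\<close> by auto
    ultimately show ?thesis using ivK by (simp add: space_circle_measure)
  qed
  also have "\<dots> < e"
    using K(3) v(2) e by linarith
  finally show ?thesis unfolding t_def by blast
qed

section \<open>Trigonometric approximation of vector-valued functions in L2\<close>

lemma simple_imp_strongly_measurable:
  "simple_function M s \<Longrightarrow> strongly_measurable M s"
  unfolding strongly_measurable_def by (intro exI[of _ "\<lambda>_. s"]) auto

lemma strongly_measurable_circle_norm:
  assumes "strongly_measurable circle_measure g"
  shows "(\<lambda>z. norm (g z)) \<in> borel_measurable circle_measure"
  by (intro strongly_measurable_circle_borel strongly_measurable_compose[OF assms] continuous_intros)

lemma strongly_measurable_diff:
  fixes f g :: "'a \<Rightarrow> 'b::real_normed_vector"
  assumes "strongly_measurable M f" "strongly_measurable M g"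
  shows "strongly_measurable M (\<lambda>x. f x - g x)"
  by (rule strongly_measurable_compose2[OF assms]) (simp add: case_prod_beta continuous_intros)

lemma L2_circleD:
  assumes "g \<in> L2_circle"
  shows "strongly_measurable circle_measure g" "integrable circle_measure (\<lambda>z. (norm (g z))\<^sup>2)"
  using assms by (auto simp: L2_circle_def)

lemma L2_circle_simple_approx:
  fixes g :: "complex \<Rightarrow> 'h::complex_hilbert_space"
  assumes g: "g \<in> L2_circle" and e: "e > 0"
  shows "\<exists>s. simple_function circle_measure s \<and> (\<integral>z. (norm (g z - s z))\<^sup>2 \<partial>circle_measure) < e"
proof -
  obtain s where s: "\<And>n. simple_function circle_measure (s n)" "AE z in circle_measure. (\<lambda>n. s n z) \<longlonglongrightarrow> g z"
    using L2_circleD(1)[OF g] by (auto simp: strongly_measurable_def)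
  \<comment> \<open>The truncation supplies the dominating function
    \<open>9 * (norm (g z))^2\<close> without disturbing the limit: where \<open>g z\<close> is
    nonzero the condition eventually holds, and where \<open>g z = 0\<close> it forces the value 0.
    Only norms enter the condition, so its measurability is a scalar matter.\<close>
  define r where "r n z = (if norm (s n z) \<le> 2 * norm (g z) then s n z else 0)" for n z
  have sn: "strongly_measurable circle_measure (s n)" for n
    by (rule simple_imp_strongly_measurable[OF s(1)])
  note [measurable] = strongly_measurable_circle_norm[OF sn] strongly_measurable_circle_norm[OF L2_circleD(1)[OF g]]
    strongly_measurable_circle_norm[OF strongly_measurable_diff[OF L2_circleD(1)[OF g] sn]]
  have r: "simple_function circle_measure (r n)" for n
    unfolding r_def by (rule simple_function_If[OF s(1)]) auto
  have "(\<lambda>n. \<integral>z. (norm (g z - r n z))\<^sup>2 \<partial>circle_measure) \<longlonglongrightarrow> (\<integral>z. 0 \<partial>circle_measure)"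
  proof (rule integral_dominated_convergence[where w = "\<lambda>z. 9 * (norm (g z))\<^sup>2"])
    show "integrable circle_measure (\<lambda>z. 9 * (norm (g z))\<^sup>2)"
      using L2_circleD(2)[OF g] by simp
    show "(\<lambda>z. (norm (g z - r n z))\<^sup>2) \<in> borel_measurable circle_measure" for n
    proof -
      have "norm (g z - r n z) = (if norm (s n z) \<le> 2 * norm (g z) then norm (g z - s n z) else norm (g z))" for z
        by (simp add: r_def)
      then show ?thesis by simp
    qed
    show "AE z in circle_measure. norm ((norm (g z - r n z))\<^sup>2) \<le> 9 * (norm (g z))\<^sup>2" for n
    proof (rule AE_I2)
      fix z
      have "norm (g z - r n z) \<le> 3 * norm (g z)"
        using norm_triangle_ineq4[of "g z" "r n z"] by (auto simp: r_def split: if_splits)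
      then have "(norm (g z - r n z))\<^sup>2 \<le> (3 * norm (g z))\<^sup>2" by (intro power_mono) auto
      then show "norm ((norm (g z - r n z))\<^sup>2) \<le> 9 * (norm (g z))\<^sup>2"
        by (simp add: power_mult_distrib)
    qed
    show "AE z in circle_measure. (\<lambda>n. (norm (g z - r n z))\<^sup>2) \<longlonglongrightarrow> 0"
      using s(2)
    proof eventually_elim
      case (elim z)
      have "(\<lambda>n. r n z) \<longlonglongrightarrow> g z"
      proof (cases "g z = 0")
        case True
        then have "r n z = 0" for n by (simp add: r_def)
        then show ?thesis using True by simp
      next
        case False
        then have "norm (g z) < 2 * norm (g z)" by simp
        with tendsto_norm[OF elim] have "\<forall>\<^sub>F n in sequentially. norm (s n z) < 2 * norm (g z)"
          by (rule order_tendstoD(2))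
        then have "\<forall>\<^sub>F n in sequentially. s n z = r n z"
          by eventually_elim (simp add: r_def)
        with elim show ?thesis by (rule Lim_transform_eventually)
      qed
      then have "(\<lambda>n. (norm (g z - r n z))\<^sup>2) \<longlonglongrightarrow> (norm (g z - g z))\<^sup>2"
        by (intro tendsto_intros)
      then show ?case by simp
    qed
  qed auto
  then have "\<forall>\<^sub>F n in sequentially. (\<integral>z. (norm (g z - r n z))\<^sup>2 \<partial>circle_measure) < e"
    using e by (intro order_tendstoD(2)) auto
  then obtain n where "(\<integral>z. (norm (g z - r n z))\<^sup>2 \<partial>circle_measure) < e"
    by (auto simp: eventually_sequentially)
  with r show ?thesis by blast
qed

lemma L2_circle_continuous:
  fixes G :: "complex \<Rightarrow> 'h::complex_hilbert_space"
  assumes "continuous_on UNIV G"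
  shows "G \<in> L2_circle"
  unfolding L2_circle_def
  by (auto intro!: strongly_measurable_circle_continuous integrable_circle_continuous continuous_intros
      assms continuous_on_subset[OF assms])

lemma integrable_norm_diff_sq:
  fixes g h :: "complex \<Rightarrow> 'h::complex_hilbert_space"
  assumes g: "strongly_measurable circle_measure g" "integrable circle_measure (\<lambda>z. (norm (g z))\<^sup>2)"
    and h: "strongly_measurable circle_measure h" "integrable circle_measure (\<lambda>z. (norm (h z))\<^sup>2)"
  shows "integrable circle_measure (\<lambda>z. (norm (g z - h z))\<^sup>2)"
proof (rule Bochner_Integration.integrable_bound)
  show "integrable circle_measure (\<lambda>z. 2 * (norm (g z))\<^sup>2 + 2 * (norm (h z))\<^sup>2)"
    using g h by simp
  note [measurable] = strongly_measurable_circle_norm[OF strongly_measurable_diff[OF g(1) h(1)]]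
  show "(\<lambda>z. (norm (g z - h z))\<^sup>2) \<in> borel_measurable circle_measure" by measurable
  show "AE z in circle_measure. norm ((norm (g z - h z))\<^sup>2) \<le> norm (2 * (norm (g z))\<^sup>2 + 2 * (norm (h z))\<^sup>2)"
    using norm_diff_sq_le[of "g z" "h z" 0 for z] by (auto intro!: AE_I2 )
qed

lemma L2_circle_diff: "g \<in> L2_circle \<Longrightarrow> h \<in> L2_circle \<Longrightarrow> (\<lambda>z. g z - h z) \<in> L2_circle"
  by (auto simp: L2_circle_def intro!: integrable_norm_diff_sq strongly_measurable_diff)

lemma simple_trig_approx:
  fixes s :: "complex \<Rightarrow> 'h::complex_hilbert_space"
  assumes s: "simple_function circle_measure s" and e: "e > 0"
  shows "\<exists>Y p q. finite Y \<and>
    (\<integral>z. (norm (s z - (\<Sum>y\<in>Y. trig_poly (p y) (q y) z *\<^sub>C y)))\<^sup>2 \<partial>circle_measure) \<le> e"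
proof -
  define Y where "Y = s ` unit_circle"
  define A where "A y = s -` {y} \<inter> unit_circle" for y
  have finY: "finite Y" using s by (simp add: simple_function_def Y_def space_circle_measure)
  have A: "A y \<in> sets circle_measure" for y
    using simple_functionD(2)[OF s, of "{y}"] by (simp add: A_def space_circle_measure)
  note [measurable] = A
  define S where "S = (\<Sum>y\<in>Y. (norm y)\<^sup>2)"
  have S: "S \<ge> 0" by (auto simp: S_def intro: sum_nonneg)
  \<comment> \<open>The error is at most \<open>card Y * S * d\<close>; the two summands 1 keep the
    denominator positive when \<open>Y\<close> or \<open>S\<close> vanishes.\<close>
  define d where "d = e / ((card Y + 1) * (S + 1))"
  have d: "d > 0" using e S by (simp add: d_def)
  have "\<forall>y. \<exists>p q. (\<integral>z. (cmod (indicator (A y) z - trig_poly p q z))\<^sup>2 \<partial>circle_measure) < d"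
    using trig_poly_dense_indicator[OF A d] by blast
  then obtain p q where pq:
    "\<And>y. (\<integral>z. (cmod (indicator (A y) z - trig_poly (p y) (q y) z))\<^sup>2 \<partial>circle_measure) < d"
    by metis
  define t where "t y = trig_poly (p y) (q y)" for y
  have [measurable]: "t y \<in> borel_measurable circle_measure" for y
    unfolding t_def by (intro continuous_on_circle_measurable continuous_intros)
  have int: "integrable circle_measure (\<lambda>z. (cmod (indicator (A y) z - t y z))\<^sup>2)" for y
  proof -
    have "continuous_on unit_circle (t y)" unfolding t_def by (intro continuous_intros)
    then obtain B where B: "\<forall>z\<in>unit_circle. norm (t y z) \<le> B"
      using continuous_on_circle_bounded[of "t y"] by auto
    show ?thesis
    proof (rule circle.integrable_const_bound[where B = "(1 + B)\<^sup>2"])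
      show "AE z in circle_measure. norm ((cmod (indicator (A y) z - t y z))\<^sup>2) \<le> (1 + B)\<^sup>2"
      proof (rule AE_I2)
        fix z assume "z \<in> space circle_measure"
        then have "cmod (t y z) \<le> B" using B by (simp add: space_circle_measure)
        then have "cmod (indicator (A y) z - t y z) \<le> 1 + B"
          using norm_triangle_ineq4[of "indicator (A y) z" "t y z"] by (auto simp: indicator_def)
        then show "norm ((cmod (indicator (A y) z - t y z))\<^sup>2) \<le> (1 + B)\<^sup>2"
          using power_mono[of "cmod (indicator (A y) z - t y z)" "1 + B" 2] by simp
      qed
    qed measurable
  qed
  have le: "(norm (s z - (\<Sum>y\<in>Y. t y z *\<^sub>C y)))\<^sup>2
      \<le> card Y * (\<Sum>y\<in>Y. (norm y)\<^sup>2 * (cmod (indicator (A y) z - t y z))\<^sup>2)" if z: "z \<in> unit_circle" for z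
  proof -
    have "(\<Sum>y\<in>Y. indicator (A y) z *\<^sub>C y) = (\<Sum>y\<in>Y. if y = s z then s z else 0)"
      using z by (intro sum.cong) (auto simp: A_def indicator_def scaleC_one scaleC.zero_left)
    also have "\<dots> = s z" using z finY by (simp add: Y_def)
    finally have "s z - (\<Sum>y\<in>Y. t y z *\<^sub>C y) = (\<Sum>y\<in>Y. (indicator (A y) z - t y z) *\<^sub>C y)"
      by (simp add: scaleC.diff_left sum_subtractf)
    then show ?thesis
      using norm_sum_sq_le[of "\<lambda>y. (indicator (A y) z - t y z) *\<^sub>C y" Y]
      by (simp add: norm_scaleC power_mult_distrib mult.commute)
  qed
  have "(\<integral>z. (norm (s z - (\<Sum>y\<in>Y. t y z *\<^sub>C y)))\<^sup>2 \<partial>circle_measure)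
      \<le> (\<integral>z. card Y * (\<Sum>y\<in>Y. (norm y)\<^sup>2 * (cmod (indicator (A y) z - t y z))\<^sup>2) \<partial>circle_measure)"
  proof (rule integral_mono_AE')
    show "integrable circle_measure (\<lambda>z. card Y * (\<Sum>y\<in>Y. (norm y)\<^sup>2 * (cmod (indicator (A y) z - t y z))\<^sup>2))"
      using int by simp
  qed (auto intro!: AE_I2 le mult_nonneg_nonneg sum_nonneg simp: space_circle_measure)
  also have "\<dots> = card Y * (\<Sum>y\<in>Y. (norm y)\<^sup>2 * (\<integral>z. (cmod (indicator (A y) z - t y z))\<^sup>2 \<partial>circle_measure))"
    using int by simp
  also have "\<dots> \<le> card Y * (\<Sum>y\<in>Y. (norm y)\<^sup>2 * d)"
    unfolding t_def by (intro mult_left_mono sum_mono pq[THEN less_imp_le]) auto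
  also have "\<dots> = (card Y * S) * d" by (simp add: S_def sum_distrib_right)
  also have "\<dots> \<le> ((card Y + 1) * (S + 1)) * d"
    using d S by (intro mult_right_mono mult_mono) auto
  also have "\<dots> = e" using S by (simp add: d_def)
  finally show ?thesis using finY unfolding t_def by blast
qed

lemma continuous_on_vec_trig [continuous_intros]:
  fixes Y :: "'h::complex_hilbert_space set"
  shows "continuous_on A (\<lambda>z. \<Sum>y\<in>Y. trig_poly (p y) (q y) z *\<^sub>C y)"
  by (intro continuous_intros scaleC.continuous_on)

lemma L2_circle_trig_approx:
  fixes g :: "complex \<Rightarrow> 'h::complex_hilbert_space"
  assumes g: "g \<in> L2_circle" and e: "e > 0"
  shows "\<exists>Y p q. finite Y \<and>
    (\<integral>z. (norm (g z - (\<Sum>y\<in>Y. trig_poly (p y) (q y) z *\<^sub>C y)))\<^sup>2 \<partial>circle_measure) < e"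
proof -
  obtain s where s: "simple_function circle_measure s" "(\<integral>z. (norm (g z - s z))\<^sup>2 \<partial>circle_measure) < e / 4"
    using L2_circle_simple_approx[OF g, of "e / 4"] e by auto
  obtain Y p q where Y: "finite Y"
    "(\<integral>z. (norm (s z - (\<Sum>y\<in>Y. trig_poly (p y) (q y) z *\<^sub>C y)))\<^sup>2 \<partial>circle_measure) \<le> e / 4"
    using simple_trig_approx[OF s(1), of "e / 4"] e by auto
  define t where "t = (\<lambda>z. \<Sum>y\<in>Y. trig_poly (p y) (q y) z *\<^sub>C y)"
  have sM: "strongly_measurable circle_measure s" by (rule simple_imp_strongly_measurable[OF s(1)])
  have "finite (s ` unit_circle)" using s by (simp add: simple_function_def space_circle_measure)
  then obtain B where B: "\<forall>z\<in>unit_circle. norm (s z) \<le> B"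
    using finite_imp_bounded bounded_iff by (metis image_eqI)
  note [measurable] = strongly_measurable_circle_norm[OF sM]
  have "integrable circle_measure (\<lambda>z. (norm (s z))\<^sup>2)"
    by (rule circle.integrable_const_bound[where B = "B\<^sup>2"])
      (use B in \<open>auto intro!: AE_I2 power_mono simp: space_circle_measure\<close>)
  then have s2: "s \<in> L2_circle" using sM by (simp add: L2_circle_def)
  have t2: "t \<in> L2_circle"
    unfolding t_def by (intro L2_circle_continuous continuous_intros)
  have i1: "integrable circle_measure (\<lambda>z. (norm (g z - s z))\<^sup>2)"
    using L2_circleD(2)[OF L2_circle_diff[OF g s2]] .
  have i2: "integrable circle_measure (\<lambda>z. (norm (s z - t z))\<^sup>2)"
    using L2_circleD(2)[OF L2_circle_diff[OF s2 t2]] .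
  have "(\<integral>z. (norm (g z - t z))\<^sup>2 \<partial>circle_measure)
      \<le> (\<integral>z. 2 * (norm (g z - s z))\<^sup>2 + 2 * (norm (s z - t z))\<^sup>2 \<partial>circle_measure)"
    by (rule integral_mono_AE') (use i1 i2 in \<open>auto intro!: AE_I2 norm_diff_sq_le\<close>)
  also have "\<dots> = 2 * (\<integral>z. (norm (g z - s z))\<^sup>2 \<partial>circle_measure) + 2 * (\<integral>z. (norm (s z - t z))\<^sup>2 \<partial>circle_measure)"
    using i1 i2 by simp
  also have "\<dots> < e" using s(2) Y(2) unfolding t_def by linarith
  finally show ?thesis using Y(1) unfolding t_def by blast
qed

subsection \<open>Density of polynomials in \<open>H\<^sup>2(H)\<close>\<close>

text \<open>Every sesquilinear or bilinear integral below has a scalar integrand of this kind, the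
  factor \<open>B\<close> coming from a bounded symbol or multiplier. The vector functions thus
  enter only through their norms.\<close>

lemma L2_product_bound:
  fixes g h :: "complex \<Rightarrow> 'h::complex_hilbert_space" and F :: "complex \<Rightarrow> complex"
  assumes g: "g \<in> L2_circle" and h: "h \<in> L2_circle" and F: "F \<in> borel_measurable circle_measure"
    and le: "\<And>z. z \<in> unit_circle \<Longrightarrow> cmod (F z) \<le> B * (norm (g z) * norm (h z))" and B: "B \<ge> 0"
  shows "integrable circle_measure F"
    and "cmod (integral\<^sup>L circle_measure F) \<le> B * (L2_circle_norm g * L2_circle_norm h)"
proof -
  note [measurable] = F strongly_measurable_circle_norm[OF L2_circleD(1)[OF g]]
    strongly_measurable_circle_norm[OF L2_circleD(1)[OF h]]
  have igh: "integrable circle_measure (\<lambda>z. norm (g z) * norm (h z))"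
    by (rule integrable_mult_of_squares) (use L2_circleD(2)[OF g] L2_circleD(2)[OF h] in auto)
  show int: "integrable circle_measure F"
  proof (rule Bochner_Integration.integrable_bound)
    show "integrable circle_measure (\<lambda>z. B * (norm (g z) * norm (h z)))" using igh by simp
    show "AE z in circle_measure. norm (F z) \<le> norm (B * (norm (g z) * norm (h z)))"
      using le B by (auto intro!: AE_I2 simp: space_circle_measure abs_mult)
  qed fact
  have "cmod (integral\<^sup>L circle_measure F) \<le> (\<integral>z. cmod (F z) \<partial>circle_measure)"
    by (rule integral_norm_bound)
  also have "\<dots> \<le> (\<integral>z. B * (norm (g z) * norm (h z)) \<partial>circle_measure)"
    by (rule integral_mono) (use int igh le in \<open>auto simp: space_circle_measure\<close>)
  also have "\<dots> = B * (\<integral>z. norm (g z) * norm (h z) \<partial>circle_measure)" by simp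
  also have "\<dots> \<le> B * (L2_circle_norm g * L2_circle_norm h)"
    unfolding L2_circle_norm_def
    by (intro mult_left_mono integral_Cauchy_Schwarz B) (use L2_circleD(2)[OF g] L2_circleD(2)[OF h] in auto)
  finally show "cmod (integral\<^sup>L circle_measure F) \<le> B * (L2_circle_norm g * L2_circle_norm h)" .
qed

lemma L2_circle_norm_nonneg: "L2_circle_norm g \<ge> 0"
  by (simp add: L2_circle_norm_def)

lemma strongly_measurable_cinner:
  fixes f g :: "'a \<Rightarrow> 'h::complex_hilbert_space"
  assumes "strongly_measurable M f" "strongly_measurable M g"
  shows "strongly_measurable M (\<lambda>x. cinner (f x) (g x))"
  by (rule strongly_measurable_compose2[OF assms])
    (auto simp: case_prod_beta intro!: cinner.continuous_on continuous_intros)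

lemma cinner_measurable_circle:
  fixes f g :: "complex \<Rightarrow> 'h::complex_hilbert_space"
  assumes "f \<in> L2_circle" "g \<in> L2_circle"
  shows "(\<lambda>z. cinner (f z) (g z)) \<in> borel_measurable circle_measure"
  by (intro strongly_measurable_circle_borel strongly_measurable_cinner L2_circleD assms)

lemma integrable_cinner_L2:
  fixes g h :: "complex \<Rightarrow> 'h::complex_hilbert_space"
  assumes g: "g \<in> L2_circle" and h: "h \<in> L2_circle" and c: "continuous_on unit_circle c"
  shows "integrable circle_measure (\<lambda>z. c z * cinner (g z) (h z))"
proof -
  obtain B where B: "B > 0" "\<forall>z\<in>unit_circle. cmod (c z) \<le> B"
    using continuous_on_circle_bounded[OF c] by auto
  note [measurable] = continuous_on_circle_measurable[OF c] cinner_measurable_circle[OF g h]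
  show ?thesis
  proof (rule L2_product_bound(1)[OF g h])
    show "cmod (c z * cinner (g z) (h z)) \<le> B * (norm (g z) * norm (h z))" if "z \<in> unit_circle" for z
      using B that by (auto simp: norm_mult intro!: mult_mono cmod_cinner_le)
  qed (use B in auto)
qed

lemma const_L2_circle: "(\<lambda>z. y) \<in> L2_circle"
  by (intro L2_circle_continuous continuous_intros)

text \<open>An \<open>H\<close>-valued polynomial as a finite sum of scalar polynomials times
  vectors, the vectors being their own index set.\<close>

definition vec_poly :: "'h::complex_hilbert_space set \<Rightarrow> ('h \<Rightarrow> complex poly) \<Rightarrow> complex \<Rightarrow> 'h" where
  "vec_poly Y p z = (\<Sum>y\<in>Y. poly (p y) z *\<^sub>C y)"

lemma continuous_on_vec_poly [continuous_intros]: "continuous_on A (vec_poly Y p)"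
  unfolding vec_poly_def by (intro continuous_intros scaleC.continuous_on)

lemma vec_poly_L2_circle: "vec_poly Y p \<in> L2_circle"
  by (intro L2_circle_continuous continuous_intros)

text \<open>Projecting onto the nonnegative frequencies moves a trigonometric approximant closer to an
  element of \<open>H\<^sup>2(H)\<close>.\<close>

lemma hardy2_poly_approx:
  fixes g :: "complex \<Rightarrow> 'h::complex_hilbert_space"
  assumes g: "g \<in> hardy2" and e: "e > 0"
  shows "\<exists>Y p. finite Y \<and> (\<integral>z. (norm (g z - vec_poly Y p z))\<^sup>2 \<partial>circle_measure) < e"
proof -
  have g2: "g \<in> L2_circle" using g by (simp add: hardy2_def)
  obtain Y p q where Y: "finite Y"
    and app: "(\<integral>z. (norm (g z - (\<Sum>y\<in>Y. trig_poly (p y) (q y) z *\<^sub>C y)))\<^sup>2 \<partial>circle_measure) < e"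
    using L2_circle_trig_approx[OF g2 e] by blast
  define P where "P = vec_poly Y p"
  define d where "d = (\<lambda>z. g z - P z)"
  define n where "n = (\<lambda>z. \<Sum>y\<in>Y. (cnj z * poly (q y) (cnj z)) *\<^sub>C y)"
  have t: "(\<Sum>y\<in>Y. trig_poly (p y) (q y) z *\<^sub>C y) = P z + n z" for z
    by (simp add: trig_poly_def P_def n_def scaleC_add_left sum.distrib vec_poly_def)
  have P2: "P \<in> L2_circle"
    unfolding P_def by (rule vec_poly_L2_circle)
  have n2: "n \<in> L2_circle"
    unfolding n_def by (intro L2_circle_continuous continuous_intros scaleC.continuous_on)
  have d2: "d \<in> L2_circle"
    unfolding d_def by (rule L2_circle_diff[OF g2 P2])
  \<comment> \<open>This is the Fourier coefficient of index \<open>- Suc k\<close>: for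
    \<open>g\<close> it vanishes by membership in \<open>hardy2\<close>, for \<open>P\<close>
    because \<open>z ^ Suc k * P\<close> has no constant term.\<close>
  have pow: "(\<integral>z. z ^ Suc k * cinner (d z) y \<partial>circle_measure) = 0" for k y
  proof -
    have "has_fourier_coeff g (- int (Suc k)) 0"
      using g by (auto simp: hardy2_def)
    then have "fourier_coeff (\<lambda>z. cinner (g z) y) (- int (Suc k)) = 0"
      unfolding has_fourier_coeff_def cinner.zero_left by blast
    then have 1: "(\<integral>z. z ^ Suc k * cinner (g z) y \<partial>circle_measure) = 0"
      unfolding fourier_coeff_def minus_minus power_int_of_nat .
    have "(\<integral>z. z ^ Suc k * cinner (P z) y \<partial>circle_measure)
        = (\<integral>z. cnj z ^ 0 * poly (\<Sum>x\<in>Y. smult (cinner x y) (monom 1 (Suc k) * p x)) z \<partial>circle_measure)"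
      by (rule Bochner_Integration.integral_cong)
        (simp_all add: P_def vec_poly_def cinner.sum_left cinner_scaleC_left poly_sum poly_monom sum_distrib_left mult_ac)
    also have "\<dots> = 0"
      unfolding integral_circle_cnj_power_poly by (simp add: coeff_sum coeff_mult)
    finally have 2: "(\<integral>z. z ^ Suc k * cinner (P z) y \<partial>circle_measure) = 0" .
    have "(\<integral>z. z ^ Suc k * cinner (d z) y \<partial>circle_measure)
        = (\<integral>z. z ^ Suc k * cinner (g z) y - z ^ Suc k * cinner (P z) y \<partial>circle_measure)"
      by (simp add: d_def cinner.diff_left right_diff_distrib)
    also have "\<dots> = 0"
      by (subst Bochner_Integration.integral_diff)
        (use 1 2 in \<open>auto intro!: integrable_cinner_L2 g2 P2 const_L2_circle continuous_intros simp del: power_Suc\<close>)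
    finally show ?thesis .
  qed
  have poly0: "(\<integral>z. z * poly r z * cinner (d z) y \<partial>circle_measure) = 0" for r y
  proof -
    have "(\<integral>z. z * poly r z * cinner (d z) y \<partial>circle_measure)
        = (\<integral>z. (\<Sum>i\<le>degree r. coeff r i * (z ^ Suc i * cinner (d z) y)) \<partial>circle_measure)"
      by (simp add: poly_altdef sum_distrib_left sum_distrib_right mult_ac)
    also have "\<dots> = (\<Sum>i\<le>degree r. coeff r i * (\<integral>z. z ^ Suc i * cinner (d z) y \<partial>circle_measure))"
      by (subst Bochner_Integration.integral_sum)
        (auto intro!: integrable_mult_right integrable_cinner_L2 d2 const_L2_circle continuous_intros simp del: power_Suc)
    also have "\<dots> = 0" unfolding pow by simp
    finally show ?thesis .
  qed
  \<comment> \<open>\<open>d\<close> has no negative frequencies and \<open>n\<close> has only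
    negative ones.\<close>
  have orth: "(\<integral>z. cinner (d z) (n z) \<partial>circle_measure) = 0"
  proof -
    have "(\<integral>z. cinner (d z) (n z) \<partial>circle_measure)
        = (\<integral>z. (\<Sum>y\<in>Y. z * poly (map_poly cnj (q y)) z * cinner (d z) y) \<partial>circle_measure)"
      by (simp add: n_def cinner.sum_right cinner_scaleC_right)
    also have "\<dots> = (\<Sum>y\<in>Y. \<integral>z. z * poly (map_poly cnj (q y)) z * cinner (d z) y \<partial>circle_measure)"
      by (rule Bochner_Integration.integral_sum)
        (intro integrable_cinner_L2 d2 const_L2_circle continuous_intros)
    also have "\<dots> = 0" unfolding poly0 by simp
    finally show ?thesis .
  qed
  have int: "integrable circle_measure (\<lambda>z. cinner (d z) (n z))"
    using integrable_cinner_L2[OF d2 n2, of "\<lambda>_. 1"] by simp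
  have "(norm (d z - n z))\<^sup>2 = (norm (d z))\<^sup>2 + (norm (n z))\<^sup>2 - 2 * Re (cinner (d z) (n z))" for z
    using dot_norm_neg[of "d z" "n z"] by (simp add: inner_eq_Re_cinner)
  then have "(\<integral>z. (norm (d z - n z))\<^sup>2 \<partial>circle_measure)
      = (\<integral>z. (norm (d z))\<^sup>2 + (norm (n z))\<^sup>2 - 2 * Re (cinner (d z) (n z)) \<partial>circle_measure)"
    by simp
  also have "\<dots> = (\<integral>z. (norm (d z))\<^sup>2 \<partial>circle_measure) + (\<integral>z. (norm (n z))\<^sup>2 \<partial>circle_measure)
      - 2 * Re (\<integral>z. cinner (d z) (n z) \<partial>circle_measure)"
    using L2_circleD(2)[OF d2] L2_circleD(2)[OF n2] int by simp
  also have "\<dots> \<ge> (\<integral>z. (norm (d z))\<^sup>2 \<partial>circle_measure)"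
    unfolding orth by simp
  finally have "(\<integral>z. (norm (d z))\<^sup>2 \<partial>circle_measure) \<le> (\<integral>z. (norm (d z - n z))\<^sup>2 \<partial>circle_measure)" .
  also have "\<dots> < e"
    using app unfolding t d_def by (simp add: diff_diff_add)
  finally show ?thesis using Y unfolding d_def P_def by blast
qed

subsection \<open>Scalar estimates\<close>

text \<open>With \<open>m\<close> the least index in the sum, the geometric series bounds it by
  \<open>4/3 * (1/4)^m\<close>, while \<open>k + 1 \<le> \<kappa> m \<le> 4 * 2^m\<close> yields
  \<open>(k + 1) * (k + 2) \<le> 32 * 4^m\<close>. The constant 43 is
  \<open>32 * 4/3 = 128/3\<close> rounded up.\<close>

lemma sum_inverse_squares_lacunary:
  fixes \<kappa> :: "nat \<Rightarrow> nat"
  assumes \<kappa>: "\<And>n. 2 ^ n \<le> \<kappa> n" "\<And>n. \<kappa> n \<le> 2 ^ (n + 2)"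
  shows "(\<Sum>n | n < N \<and> k < \<kappa> n. 1 / (real (\<kappa> n))\<^sup>2) \<le> 43 / (real (k + 1) * real (k + 2))"
proof (cases "{n. n < N \<and> k < \<kappa> n} = {}")
  case False
  define S where "S = {n. n < N \<and> k < \<kappa> n}"
  define m where "m = Min S"
  have S: "finite S" "S \<noteq> {}" using False by (auto simp: S_def)
  have m: "m \<in> S" "\<And>n. n \<in> S \<Longrightarrow> m \<le> n" using S by (auto simp: m_def)
  have geo: "(\<Sum>n\<in>{m..<N}. (1/4) ^ n) \<le> 4 / 3 * (1/4 :: real) ^ m"
  proof -
    have "m \<le> N" using m by (simp add: S_def)
    then have "(\<Sum>n\<in>{m..<N}. (1/4) ^ n) = 4 / 3 * ((1/4 :: real) ^ m - (1/4) ^ N)"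
      by (induction N rule: dec_induct) (auto simp: algebra_simps)
    then show ?thesis by simp
  qed
  have "(\<Sum>n\<in>S. 1 / (real (\<kappa> n))\<^sup>2) \<le> (\<Sum>n\<in>S. (1/4) ^ n)"
  proof (rule sum_mono)
    fix n
    have "(2 ^ n :: real)\<^sup>2 \<le> (real (\<kappa> n))\<^sup>2"
      using of_nat_mono[OF \<kappa>(1)[of n], where 'a = real] by (intro power_mono) auto
    also have "(2 ^ n :: real)\<^sup>2 = 4 ^ n" by (simp add: power2_eq_square flip: power_mult_distrib)
    finally have "4 ^ n \<le> (real (\<kappa> n))\<^sup>2" .
    moreover have "(0::real) < 4 ^ n" by simp
    ultimately have "1 / (real (\<kappa> n))\<^sup>2 \<le> 1 / 4 ^ n"
      by (metis frac_le order_refl zero_le_one)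
    then show "1 / (real (\<kappa> n))\<^sup>2 \<le> (1/4) ^ n" by (simp add: power_one_over)
  qed
  also have "\<dots> \<le> (\<Sum>n\<in>{m..<N}. (1/4) ^ n)"
    by (rule sum_mono2) (use m S in \<open>auto simp: S_def\<close>)
  also note geo
  also have "4 / 3 * (1/4 :: real) ^ m \<le> 43 / (real (k + 1) * real (k + 2))"
  proof -
    have "k + 1 \<le> 2 ^ (m + 2)" using m(1) \<kappa>(2)[of m] by (simp add: S_def)
    from of_nat_mono[OF this, where 'a = real] have 1: "real (k + 1) \<le> 4 * 2 ^ m" by simp
    have "real (k + 1) * real (k + 2) \<le> real (k + 1) * (2 * real (k + 1))"
      by (intro mult_left_mono) auto
    also have "\<dots> \<le> (4 * 2 ^ m) * (2 * (4 * 2 ^ m))"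
      by (intro mult_mono 1) auto
    also have "\<dots> = 32 * 4 ^ m"
      by (simp add: mult_ac flip: power_mult_distrib)
    finally have "real (k + 1) * real (k + 2) \<le> 32 * 4 ^ m" .
    moreover have "4 / 3 * (1 / a) \<le> 43 / X" if "X \<le> 32 * a" "0 < X" for X a :: real
      using that by (simp add: field_simps)
    ultimately show ?thesis by (simp add: power_one_over)
  qed
  finally show ?thesis by (simp add: S_def)
next
  case True
  show ?thesis unfolding True by simp
qed

text \<open>The weight is the integral of \<open>t^k * (1 - t)\<close> over [0, 1], so the
  hypothesis is integrated against \<open>1 - t\<close>. \<open>G\<close> is the antiderivative
  vanishing at 0, and its monotonicity stands in for the integral.\<close>

lemma sum_weighted_nonneg:
  fixes c :: "nat \<Rightarrow> real"
  assumes "\<And>t. 0 \<le> t \<Longrightarrow> t \<le> 1 \<Longrightarrow> 0 \<le> (\<Sum>k\<le>d. c k * t ^ k)"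
  shows "0 \<le> (\<Sum>k\<le>d. c k / (real (k + 1) * real (k + 2)))"
proof -
  define G where "G t = (\<Sum>k\<le>d. c k * (t ^ (k + 1) / real (k + 1) - t ^ (k + 2) / real (k + 2)))" for t
  have "G 0 \<le> G 1"
  proof (rule DERIV_nonneg_imp_nondecreasing[of 0 1])
    fix t :: real assume t: "0 \<le> t" "t \<le> 1"
    have "((\<lambda>t. t ^ Suc j / real (Suc j)) has_real_derivative t ^ j) (at t)" for j
      using DERIV_cdivide[OF DERIV_pow[of "Suc j" t], of "real (Suc j)"] by (simp del: of_nat_Suc)
    from this[of k for k] this[of "Suc k" for k]
    have "(G has_real_derivative (\<Sum>k\<le>d. c k * (t ^ k - t ^ Suc k))) (at t)"
      unfolding G_def by (intro DERIV_sum DERIV_cmult DERIV_diff) (simp_all add: numeral_2_eq_2)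
    moreover have "(\<Sum>k\<le>d. c k * (t ^ k - t ^ Suc k)) = (1 - t) * (\<Sum>k\<le>d. c k * t ^ k)"
      by (simp add: sum_distrib_left algebra_simps)
    ultimately show "\<exists>y. (G has_real_derivative y) (at t) \<and> 0 \<le> y"
      using assms[OF t] t by (intro exI[of _ "\<Sum>k\<le>d. c k * (t ^ k - t ^ Suc k)"] conjI) simp_all
  qed simp
  moreover have "G 0 = 0" by (simp add: G_def)
  moreover have "G 1 = (\<Sum>k\<le>d. c k / (real (k + 1) * real (k + 2)))"
    unfolding G_def by (intro sum.cong) (auto simp: field_simps)
  ultimately show ?thesis by simp
qed

section \<open>Weighted Bergman norms and the Carleson embedding\<close>

lemma poly_norm_le_unit_disc:
  assumes F: "\<And>z. z \<in> unit_circle \<Longrightarrow> cmod (poly f z) \<le> F" and z: "cmod z \<le> 1"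
  shows "cmod (poly f z) \<le> F"
proof (rule maximum_modulus_frontier[where f = "poly f" and S = "cball 0 1"])
  show "poly f holomorphic_on interior (cball 0 1)" by (intro holomorphic_intros)
qed (use z F in \<open>auto intro!: continuous_intros\<close>)

lemma parseval_poly_upto:
  assumes "degree p \<le> d"
  shows "integral\<^sup>L circle_measure (\<lambda>z. (cmod (poly p z))\<^sup>2) = (\<Sum>k\<le>d. (cmod (coeff p k))\<^sup>2)"
  unfolding parseval_poly
  by (rule sum.mono_neutral_left) (use assms in \<open>auto simp: coeff_eq_0\<close>)

lemma integral_mult_poly_sq_le:
  assumes F: "\<And>z. z \<in> unit_circle \<Longrightarrow> cmod (poly f z) \<le> F"
  shows "(\<integral>z. (cmod (poly (f * g) z))\<^sup>2 \<partial>circle_measure) \<le> F\<^sup>2 * (\<integral>z. (cmod (poly g z))\<^sup>2 \<partial>circle_measure)"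
proof -
  have "(\<integral>z. (cmod (poly (f * g) z))\<^sup>2 \<partial>circle_measure) \<le> (\<integral>z. F\<^sup>2 * (cmod (poly g z))\<^sup>2 \<partial>circle_measure)"
  proof (rule integral_mono)
    fix z assume "z \<in> space circle_measure"
    then show "(cmod (poly (f * g) z))\<^sup>2 \<le> F\<^sup>2 * (cmod (poly g z))\<^sup>2"
      using F[of z] by (auto simp: space_circle_measure norm_mult power_mult_distrib intro!: mult_right_mono power_mono)
  qed (intro integrable_circle_continuous continuous_intros)+
  then show ?thesis by simp
qed

text \<open>Multiplication by a bounded analytic function is bounded on the weighted Bergman space with
  monomial weights \<open>1 / ((k + 1) (k + 2))\<close>, these being the moments of \<open>1 - t\<close> with \<open>t = |z|\<^sup>2\<close>.\<close>

lemma bergman_mult_le: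
  assumes F: "\<And>z. z \<in> unit_circle \<Longrightarrow> cmod (poly f z) \<le> F"
    and d: "degree (f * g) \<le> d" "degree g \<le> d"
  shows "(\<Sum>k\<le>d. (cmod (coeff (f * g) k))\<^sup>2 / (real (k + 1) * real (k + 2)))
    \<le> F\<^sup>2 * (\<Sum>k\<le>d. (cmod (coeff g k))\<^sup>2 / (real (k + 1) * real (k + 2)))"
proof -
  define c where "c k = F\<^sup>2 * (cmod (coeff g k))\<^sup>2 - (cmod (coeff (f * g) k))\<^sup>2" for k
  have "0 \<le> (\<Sum>k\<le>d. c k / (real (k + 1) * real (k + 2)))"
  proof (rule sum_weighted_nonneg)
    fix t :: real assume t: "0 \<le> t" "t \<le> 1"
    \<comment> \<open>\<open>s\<close> is dilation by \<open>sqrt t\<close>. By Parseval, the sum of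
      \<open>(cmod (coeff p k))^2 * t^k\<close> is the mean of \<open>|p|^2\<close> over the circle
      of radius \<open>sqrt t\<close>, and there \<open>f\<close> is still bounded by
      \<open>F\<close>, by the maximum principle.\<close>
    define s where "s p = pcompose p [:0, complex_of_real (sqrt t):]" for p
    have co: "coeff (s p) k = complex_of_real (sqrt t) ^ k * coeff p k" for p k
      by (simp add: s_def coeff_pcompose_linear)
    have sq: "(cmod (coeff (s p) k))\<^sup>2 = (cmod (coeff p k))\<^sup>2 * t ^ k" for p k
      using t by (simp add: co norm_mult norm_power power_mult_distrib abs_of_nonneg
          flip: power_mult power_mult[of _ 2] ) (simp add: power_mult mult.commute[of k 2])
    have deg: "degree (s p) \<le> degree p" for p
      by (simp add: s_def degree_pcompose)
    have bd: "cmod (poly (s f) z) \<le> F" if "z \<in> unit_circle" for z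
      unfolding s_def poly_pcompose
      by (rule poly_norm_le_unit_disc) (use F that t in \<open>auto simp: norm_mult\<close>)
    have "(\<Sum>k\<le>d. (cmod (coeff (s (f * g)) k))\<^sup>2) \<le> F\<^sup>2 * (\<Sum>k\<le>d. (cmod (coeff (s g) k))\<^sup>2)"
      using integral_mult_poly_sq_le[OF bd, where g = "s g"] deg[of "f * g"] deg[of g] d
      by (simp add: parseval_poly_upto[of _ d, symmetric] s_def pcompose_mult)
    then show "0 \<le> (\<Sum>k\<le>d. c k * t ^ k)"
      by (simp add: sq c_def sum_distrib_left sum_subtractf algebra_simps)
  qed
  then show ?thesis
    by (simp add: c_def diff_divide_distrib sum_subtractf sum_distrib_left)
qed

text \<open>Differentiation multiplies the squared coefficient by \<open>(k + 1)^2\<close>, and the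
  weight leaves the factor \<open>(k + 1) / (k + 2) \<le> 1\<close>: differentiation is a
  contraction from \<open>H^2\<close> to the weighted Bergman space.\<close>

lemma bergman_pderiv_le:
  assumes d: "degree p \<le> Suc d"
  shows "(\<Sum>k\<le>d. (cmod (coeff (pderiv p) k))\<^sup>2 / (real (k + 1) * real (k + 2)))
    \<le> (\<integral>z. (cmod (poly p z))\<^sup>2 \<partial>circle_measure)"
proof -
  have "(\<Sum>k\<le>d. (cmod (coeff (pderiv p) k))\<^sup>2 / (real (k + 1) * real (k + 2)))
      \<le> (\<Sum>k\<le>d. (cmod (coeff p (Suc k)))\<^sup>2)"
  proof (rule sum_mono)
    fix k
    have "(cmod (coeff (pderiv p) k))\<^sup>2 = (real (k + 1))\<^sup>2 * (cmod (coeff p (Suc k)))\<^sup>2"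
      unfolding coeff_pderiv norm_mult norm_of_nat by (simp add: power_mult_distrib)
    then have "(cmod (coeff (pderiv p) k))\<^sup>2 / (real (k + 1) * real (k + 2))
        = real (k + 1) / real (k + 2) * (cmod (coeff p (Suc k)))\<^sup>2"
      by (simp add: power2_eq_square)
    also have "\<dots> \<le> 1 * (cmod (coeff p (Suc k)))\<^sup>2"
      by (intro mult_right_mono) auto
    finally show "(cmod (coeff (pderiv p) k))\<^sup>2 / (real (k + 1) * real (k + 2)) \<le> (cmod (coeff p (Suc k)))\<^sup>2"
      by simp
  qed
  also have "\<dots> \<le> (\<Sum>k\<le>Suc d. (cmod (coeff p k))\<^sup>2)"
    by (subst sum.atMost_Suc_shift) simp
  also have "\<dots> = (\<integral>z. (cmod (poly p z))\<^sup>2 \<partial>circle_measure)"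
    by (rule parseval_poly_upto[OF d, symmetric])
  finally show ?thesis .
qed

text \<open>The Carleson embedding for \<open>|f'|\<^sup>2 (1 - |z|\<^sup>2)\<close>, which for bounded \<open>f\<close> is immediate
  from \<open>f' p = (f p)' - f p'\<close>.\<close>

lemma carleson_pderiv:
  assumes F: "\<And>z. z \<in> unit_circle \<Longrightarrow> cmod (poly f z) \<le> F"
  shows "(\<Sum>k\<le>degree f + degree p. (cmod (coeff (pderiv f * p) k))\<^sup>2 / (real (k + 1) * real (k + 2)))
    \<le> 4 * F\<^sup>2 * (\<integral>z. (cmod (poly p z))\<^sup>2 \<partial>circle_measure)"
proof -
  define d where "d = degree f + degree p"
  define w where "w k = real (k + 1) * real (k + 2)" for k
  have w: "w k > 0" for k by (simp add: w_def)
  have deg: "degree (f * p) \<le> Suc d" "degree (f * pderiv p) \<le> d" "degree (pderiv p) \<le> d" "degree p \<le> Suc d"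
    using degree_mult_le[of f p] degree_mult_le[of f "pderiv p"] degree_pderiv[of p]
    by (auto simp: d_def)
  have eq: "pderiv f * p = pderiv (f * p) - f * pderiv p"
    by (simp add: pderiv_mult mult.commute)
  have "(\<Sum>k\<le>d. (cmod (coeff (pderiv f * p) k))\<^sup>2 / w k)
      \<le> (\<Sum>k\<le>d. 2 * ((cmod (coeff (pderiv (f * p)) k))\<^sup>2 / w k) + 2 * ((cmod (coeff (f * pderiv p) k))\<^sup>2 / w k))"
  proof (rule sum_mono)
    fix k
    have "(cmod (coeff (pderiv f * p) k))\<^sup>2
        \<le> 2 * (cmod (coeff (pderiv (f * p)) k))\<^sup>2 + 2 * (cmod (coeff (f * pderiv p) k))\<^sup>2"
      unfolding eq coeff_diff
      using norm_diff_sq_le[of "coeff (pderiv (f * p)) k" "coeff (f * pderiv p) k" 0] by simp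
    then show "(cmod (coeff (pderiv f * p) k))\<^sup>2 / w k
        \<le> 2 * ((cmod (coeff (pderiv (f * p)) k))\<^sup>2 / w k) + 2 * ((cmod (coeff (f * pderiv p) k))\<^sup>2 / w k)"
      using w[of k] by (simp add: field_simps)
  qed
  also have "\<dots> = 2 * (\<Sum>k\<le>d. (cmod (coeff (pderiv (f * p)) k))\<^sup>2 / w k)
      + 2 * (\<Sum>k\<le>d. (cmod (coeff (f * pderiv p) k))\<^sup>2 / w k)"
    by (simp add: sum.distrib sum_distrib_left)
  \<comment> \<open>For \<open>(f p)'\<close> the bound on \<open>f\<close> is used on the circle,
    before differentiating; for \<open>f p'\<close> it is used as a multiplier bound on the Bergman
    space, after which \<open>p'\<close> is estimated by \<open>p\<close>.\<close>
  also have "(\<Sum>k\<le>d. (cmod (coeff (pderiv (f * p)) k))\<^sup>2 / w k) \<le> F\<^sup>2 * (\<integral>z. (cmod (poly p z))\<^sup>2 \<partial>circle_measure)"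
    unfolding w_def by (rule order_trans[OF bergman_pderiv_le integral_mult_poly_sq_le]) (use deg F in auto)
  also have "(\<Sum>k\<le>d. (cmod (coeff (f * pderiv p) k))\<^sup>2 / w k) \<le> F\<^sup>2 * (\<Sum>k\<le>d. (cmod (coeff (pderiv p) k))\<^sup>2 / w k)"
    unfolding w_def by (rule bergman_mult_le) (use deg F in auto)
  also have "(\<Sum>k\<le>d. (cmod (coeff (pderiv p) k))\<^sup>2 / w k) \<le> (\<integral>z. (cmod (poly p z))\<^sup>2 \<partial>circle_measure)"
    unfolding w_def by (rule bergman_pderiv_le) (use deg in auto)
  finally show ?thesis unfolding d_def w_def by (simp add: mult_left_mono)
qed

text \<open>Pointwise \<open>|w|^2 = 2 * (Re w)^2 - Re (w^2)\<close>, and the mean of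
  \<open>p^2\<close> over the circle is the square of the real number \<open>coeff p 0\<close>,
  hence nonnegative. This is the L2 bound for harmonic conjugation.\<close>

lemma integral_poly_sq_le_Re:
  assumes "Im (coeff p 0) = 0"
  shows "(\<integral>z. (cmod (poly p z))\<^sup>2 \<partial>circle_measure) \<le> 2 * (\<integral>z. (Re (poly p z))\<^sup>2 \<partial>circle_measure)"
proof -
  have eq: "(cmod w)\<^sup>2 = 2 * (Re w)\<^sup>2 - Re (w * w)" for w
    by (simp add: cmod_power2) (simp add: power2_eq_square)
  have int: "integrable circle_measure (\<lambda>z. poly p z * poly p z)"
    by (intro integrable_circle_continuous continuous_intros)
  have "(\<integral>z. poly p z * poly p z \<partial>circle_measure) = coeff p 0 * coeff p 0"
    using integral_circle_cnj_power_poly[of 0 "p * p"] by (simp add: coeff_mult)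
  then have "0 \<le> Re (\<integral>z. poly p z * poly p z \<partial>circle_measure)"
    using assms by simp
  moreover have "(\<integral>z. (cmod (poly p z))\<^sup>2 \<partial>circle_measure)
      = 2 * (\<integral>z. (Re (poly p z))\<^sup>2 \<partial>circle_measure) - Re (\<integral>z. poly p z * poly p z \<partial>circle_measure)"
    unfolding eq
    by (subst Bochner_Integration.integral_diff)
      (use int in \<open>auto intro!: integrable_circle_continuous continuous_intros simp del: times_complex.sel\<close>)
  ultimately show ?thesis by simp
qed

text \<open>A substitute for the outer factor of \<open>v\<close>: a polynomial \<open>p\<close> whose real part dominates \<open>v\<close>. Since
  \<open>p\<close> maps the circle into a compact subset of the right half plane, partial sums of the Neumann
  series of \<open>1 / p\<close> provide the approximate inverse \<open>b\<close>.\<close>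

lemma outer_approx:
  assumes v: "continuous_on unit_circle v" "\<And>z. z \<in> unit_circle \<Longrightarrow> 0 \<le> v z" and e: "e > 0"
  shows "\<exists>p b. (\<forall>z\<in>unit_circle. cmod (1 - poly (p * b) z) \<le> e \<and> v z * cmod (poly b z) \<le> 1 + e) \<and>
    (\<integral>z. (cmod (poly p z))\<^sup>2 \<partial>circle_measure) \<le> 2 * (\<integral>z. (v z + e)\<^sup>2 \<partial>circle_measure)"
proof -
  \<comment> \<open>Approximating \<open>v + 2 * \<delta>\<close> within \<open>\<delta>\<close>
    puts the real part between \<open>v + \<delta>\<close> and
    \<open>v + 3 * \<delta> = v + e\<close>.\<close>
  define \<delta> where "\<delta> = e / 3"
  have \<delta>: "\<delta> > 0" using e by (simp add: \<delta>_def)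
  obtain p0 where p0: "\<forall>z\<in>unit_circle. \<bar>v z + 2 * \<delta> - Re (poly p0 z)\<bar> < \<delta>"
    using Re_poly_dense_circle[of "\<lambda>z. v z + 2 * \<delta>" \<delta>] \<delta> v by (fastforce intro: continuous_intros)
  \<comment> \<open>An imaginary constant does not alter the real part; subtracting it makes the
    constant coefficient real, as \<open>integral_poly_sq_le_Re\<close> requires.\<close>
  define p where "p = p0 - [:\<i> * Im (coeff p0 0):]"
  have Re_p: "v z + \<delta> \<le> Re (poly p z)" "Re (poly p z) \<le> v z + e" if "z \<in> unit_circle" for z
  proof -
    have "\<bar>v z + 2 * \<delta> - Re (poly p z)\<bar> < \<delta>" "e = 3 * \<delta>"
      using p0 that by (auto simp: p_def \<delta>_def)
    then show "v z + \<delta> \<le> Re (poly p z)" "Re (poly p z) \<le> v z + e" by linarith+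
  qed
  have Im0: "Im (coeff p 0) = 0" by (simp add: p_def)
  have p_cont: "continuous_on A (poly p)" for A by (intro continuous_intros)
  have "(\<integral>z. (cmod (poly p z))\<^sup>2 \<partial>circle_measure) \<le> 2 * (\<integral>z. (Re (poly p z))\<^sup>2 \<partial>circle_measure)"
    by (rule integral_poly_sq_le_Re[OF Im0])
  also have "(\<integral>z. (Re (poly p z))\<^sup>2 \<partial>circle_measure) \<le> (\<integral>z. (v z + e)\<^sup>2 \<partial>circle_measure)"
  proof (rule integral_mono)
    fix z assume "z \<in> space circle_measure"
    then have z: "z \<in> unit_circle" by (simp add: space_circle_measure)
    show "(Re (poly p z))\<^sup>2 \<le> (v z + e)\<^sup>2"
      using Re_p[OF z] v(2)[OF z] \<delta> by (intro power_mono) auto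
  qed (intro integrable_circle_continuous continuous_intros v)+
  finally have int: "(\<integral>z. (cmod (poly p z))\<^sup>2 \<partial>circle_measure) \<le> 2 * (\<integral>z. (v z + e)\<^sup>2 \<partial>circle_measure)"
    by simp
  obtain R where R: "R > 0" "\<forall>z\<in>unit_circle. cmod (poly p z) \<le> R"
    using continuous_on_circle_bounded[OF p_cont] by auto
  \<comment> \<open>This \<open>c\<close> minimises the bound
    \<open>1 - 2 * c * \<delta> + c^2 * R^2\<close> for \<open>|1 - c p|^2\<close>; the minimum is
    \<open>1 - c * \<delta>\<close>.\<close>
  define c where "c = \<delta> / R\<^sup>2"
  have c: "c > 0" using \<delta> R by (simp add: c_def)
  define \<rho> where "\<rho> = sqrt (1 - c * \<delta>)"
  have le: "(cmod (1 - of_real c * poly p z))\<^sup>2 \<le> 1 - c * \<delta>" if z: "z \<in> unit_circle" for z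
  proof -
    have "(cmod (1 - of_real c * poly p z))\<^sup>2 = 1 - 2 * (c * Re (poly p z)) + c\<^sup>2 * (cmod (poly p z))\<^sup>2"
      by (simp add: cmod_power2 power_mult_distrib) (simp add: power2_eq_square algebra_simps)
    also have "\<dots> \<le> 1 - 2 * (c * \<delta>) + c\<^sup>2 * R\<^sup>2"
      using Re_p(1)[OF z] v(2)[OF z] R z c
      by (intro add_mono diff_mono mult_left_mono power_mono) auto
    also have "c\<^sup>2 * R\<^sup>2 = c * \<delta>" using R by (simp add: c_def power2_eq_square)
    finally show ?thesis by (simp add: mult.commute)
  qed
  \<comment> \<open>At the point 1 of the circle, \<open>le\<close> bounds a square by this
    quantity.\<close>
  have "0 \<le> 1 - c * \<delta>"
    by (rule order_trans[OF zero_le_power2 le[of 1]]) simp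
  then have \<rho>: "0 \<le> \<rho>" "\<rho> < 1" using c \<delta> by (auto simp: \<rho>_def)
  obtain n where n: "\<rho> ^ n < e" using real_arch_pow_inv[OF e \<rho>(2)] by blast
  define x where "x = 1 - smult (of_real c) p"
  \<comment> \<open>The truncated Neumann series of \<open>1 / p = c / (1 - x)\<close>; its defect
    \<open>1 - p * b\<close> is exactly \<open>x ^ n\<close>.\<close>
  define b where "b = smult (of_real c) (\<Sum>j<n. x ^ j)"
  have "1 - x ^ n = (1 - x) * (\<Sum>j<n. x ^ j)" by (rule one_diff_power_eq)
  also have "\<dots> = p * b" by (simp add: x_def b_def)
  finally have pb: "1 - p * b = x ^ n" by (metis diff_diff_eq2 add_diff_cancel_left')
  have small: "cmod (1 - poly (p * b) z) \<le> e" if z: "z \<in> unit_circle" for z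
  proof -
    have "1 - poly (p * b) z = poly (1 - p * b) z" by simp
    also have "\<dots> = (1 - of_real c * poly p z) ^ n" unfolding pb by (simp add: x_def)
    finally have "cmod (1 - poly (p * b) z) = cmod (1 - of_real c * poly p z) ^ n"
      by (simp add: norm_power)
    also have "\<dots> \<le> \<rho> ^ n"
      using le[OF z] unfolding \<rho>_def by (intro power_mono real_le_rsqrt) auto
    finally show ?thesis using n by simp
  qed
  have "v z * cmod (poly b z) \<le> 1 + e" if z: "z \<in> unit_circle" for z
  proof -
    have "v z \<le> cmod (poly p z)"
      using Re_p(1)[OF z] complex_Re_le_cmod[of "poly p z"] \<delta> by linarith
    then have "v z * cmod (poly b z) \<le> cmod (poly (p * b) z)"
      by (simp add: norm_mult mult_right_mono)
    also have "\<dots> \<le> 1 + cmod (1 - poly (p * b) z)"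
      using norm_triangle_ineq4[of 1 "1 - poly (p * b) z"] by simp
    finally show ?thesis using small[OF z] by simp
  qed
  with small int show ?thesis by blast
qed

subsection \<open>Finite partial sums of the symbol\<close>

lemma scaleC_blinfun_sum_apply:
  "blinfun_apply (\<Sum>i\<in>I. a i *\<^sub>C T i) x = (\<Sum>i\<in>I. a i *\<^sub>C blinfun_apply (T i) x)"
  for T :: "'i \<Rightarrow> 'b::real_normed_vector \<Rightarrow>\<^sub>L 'h::complex_hilbert_space"
  by (simp add: blinfun.sum_left scaleC_blinfun.rep_eq)

text \<open>The sequences are renumbered from 0: \<open>\<kappa> n\<close> and \<open>D n\<close>
  stand for \<open>K_(n+1)\<close> and \<open>C_(n+1)\<close>. The exponent is \<open>n + 2\<close>
  rather than \<open>n + 1\<close> because the dyadic condition does not apply to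
  \<open>K_1\<close>, which may be 3. The l2 hypothesis is kept only for finite sums.\<close>

locale lacunary_hankel =
  fixes \<kappa> :: "nat \<Rightarrow> nat" and D :: "nat \<Rightarrow> 'h::complex_hilbert_space \<Rightarrow>\<^sub>L 'h" and J :: "'h \<Rightarrow> 'h"
  assumes \<kappa>: "\<And>n. 2 ^ n \<le> \<kappa> n" "\<And>n. \<kappa> n \<le> 2 ^ (n + 2)"
    and ops: "\<And>n. D n \<in> bounded_clinear_ops"
    and l2: "\<And>N \<alpha>. norm (\<Sum>n<N. \<alpha> n *\<^sub>C D n) \<le> sqrt (\<Sum>n<N. (cmod (\<alpha> n))\<^sup>2)"
    and J: "antilinear_isometry J"
begin

lemma \<kappa>_pos: "0 < \<kappa> n"
  using \<kappa>(1)[of n] by (metis gr0I not_one_le_zero one_le_numeral one_le_power order_trans)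

lemma inverse_\<kappa>_le: "1 / real (\<kappa> n) \<le> (1/2) ^ n"
proof -
  have "(2 ^ n :: real) \<le> real (\<kappa> n)" using of_nat_mono[OF \<kappa>(1)[of n], where 'a = real] by simp
  then have "1 / real (\<kappa> n) \<le> 1 / 2 ^ n" by (intro divide_left_mono) (auto simp: \<kappa>_pos)
  then show ?thesis by (simp add: power_one_over)
qed

lemma D_scaleC: "blinfun_apply (D n) (a *\<^sub>C x) = a *\<^sub>C blinfun_apply (D n) x"
  using ops by (simp add: bounded_clinear_ops_def)

lemma norm_D_le: "norm (D n) \<le> 1"
proof -
  have "(\<Sum>i<Suc n. (if i = n then 1 else 0) *\<^sub>C D i) = D n"
    by (rule blinfun_eqI)
      (simp add: blinfun.add_left blinfun.sum_left scaleC_blinfun.rep_eq scaleC_one scaleC.zero_left)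
  moreover have "(\<Sum>i<Suc n. (cmod (if i = n then 1 else 0))\<^sup>2) = 1" by simp
  ultimately show ?thesis using l2[where N = "Suc n" and \<alpha> = "\<lambda>i. if i = n then 1 else 0"] by simp
qed

text \<open>Differentiation turns the coefficient of index \<open>\<kappa> n\<close> into
  \<open>\<kappa> n\<close> times itself, at index \<open>\<kappa> n - 1\<close>. Integrating a
  derivative against \<open>coef n\<close> undoes both changes.\<close>

definition coef :: "nat \<Rightarrow> complex \<Rightarrow> complex" where
  "coef n z = cnj z ^ (\<kappa> n - 1) / of_nat (\<kappa> n)"

definition partial_symbol :: "nat \<Rightarrow> complex \<Rightarrow> 'h \<Rightarrow>\<^sub>L 'h" where
  "partial_symbol N z = (\<Sum>n<N. coef n z *\<^sub>C D n)"

lemma continuous_on_coef [continuous_intros]: "continuous_on A (coef n)"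
  unfolding coef_def using \<kappa>_pos by (intro continuous_intros) auto

lemma cmod_coef: "z \<in> unit_circle \<Longrightarrow> cmod (coef n z) = 1 / real (\<kappa> n)"
  by (simp add: coef_def norm_divide norm_power)

lemma norm_coef_D_le: "z \<in> unit_circle \<Longrightarrow> norm (coef n z *\<^sub>C D n) \<le> (1/2) ^ n"
  using mult_mono[OF inverse_\<kappa>_le[of n] norm_D_le[of n]]
  by (simp add: norm_scaleC_blinfun cmod_coef)

text \<open>Boundedness of the symbol comes from absolute convergence: the terms are dominated by a
  geometric series, uniformly in \<open>N\<close>.\<close>

lemma norm_partial_symbol_le:
  assumes "z \<in> unit_circle"
  shows "norm (partial_symbol N z) \<le> 2"
proof -
  have "norm (partial_symbol N z) \<le> (\<Sum>n<N. (1/2) ^ n)"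
    unfolding partial_symbol_def by (rule order_trans[OF norm_sum sum_mono[OF norm_coef_D_le[OF assms]]])
  also have "\<dots> \<le> 2" by (simp add: sum_gp_strict)
  finally show ?thesis .
qed

lemma form_coef_sum:
  "cinner (\<Sum>n<N. c n *\<^sub>C blinfun_apply (D n) (a *\<^sub>C x)) y = (\<Sum>n<N. c n * (a * cinner (blinfun_apply (D n) x) y))"
  by (simp add: cinner.sum_left cinner_scaleC_left D_scaleC)

text \<open>The antilinearity of \<open>J\<close> cancels that of the inner product in its second
  argument. The form is therefore analytic in \<open>z\<close>, and this is what allows truncation
  below.\<close>

lemma form_vec_poly:
  "\<exists>Q. \<forall>z. cinner (blinfun_apply (D n) (vec_poly Y p z)) (J (vec_poly X q z)) = poly Q z"
proof (intro exI allI)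
  fix z
  have "J (vec_poly X q z) = (\<Sum>x\<in>X. cnj (poly (q x) z) *\<^sub>C J x)"
    unfolding vec_poly_def linear_sum[OF bounded_linear.linear[OF antilinear_isometry_bounded_linear[OF J]]]
    by (simp add: antilinear_isometryD[OF J])
  then show "cinner (blinfun_apply (D n) (vec_poly Y p z)) (J (vec_poly X q z))
    = poly (\<Sum>y\<in>Y. \<Sum>x\<in>X. smult (cinner (blinfun_apply (D n) y) (J x)) (p y * q x)) z"
    by (simp add: vec_poly_def blinfun.sum_right D_scaleC cinner.sum_left cinner.sum_right
        cinner_scaleC_left cinner_scaleC_right poly_sum mult_ac sum_distrib_left) (rule sum.swap)
qed

lemma J_vec_poly_continuous: "continuous_on A (\<lambda>z. J (vec_poly X q z))"
  by (intro continuous_on_compose2[OF linear_continuous_on[OF antilinear_isometry_bounded_linear[OF J], of UNIV]]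
      continuous_intros) auto

text \<open>Only the coefficients of \<open>a\<close> below \<open>\<kappa> n\<close> contribute to the \<open>n\<close>-th term, so \<open>a\<close> may be
  truncated there. The vector \<open>b g\<close> is left untouched: the hypothesis on \<open>D\<close> controls only
  combinations with scalar coefficients.\<close>

lemma partial_form_truncated:
  fixes Y X :: "'h set"
  assumes B: "\<And>z. z \<in> unit_circle \<Longrightarrow> norm (vec_poly Y p z) * cmod (poly b z) \<le> B" and B0: "B \<ge> 0"
  shows "cmod (\<integral>z. cinner (blinfun_apply (partial_symbol N z) (poly (a * b) z *\<^sub>C vec_poly Y p z))
        (J (vec_poly X q z)) \<partial>circle_measure)
    \<le> B * (sqrt (43 * (\<Sum>k\<le>degree a. (cmod (coeff a k))\<^sup>2 / (real (k + 1) * real (k + 2))))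
        * L2_circle_norm (vec_poly X q))"
proof -
  define g where "g = vec_poly Y p"
  define h where "h = vec_poly X q"
  obtain Q where Q: "\<And>n z. cinner (blinfun_apply (D n) (g z)) (J (h z)) = poly (Q n) z"
    unfolding g_def h_def using form_vec_poly[of _ Y p X q] by metis
  define cut where "cut n = poly_cutoff (\<kappa> n) a" for n
  define \<alpha> where "\<alpha> n z = coef n z * poly (cut n) z" for n z
  \<comment> \<open>The truncated integrand. It need not agree pointwise with the original one; only
    the integrals coincide.\<close>
  define W where "W z = cinner (blinfun_apply (\<Sum>n<N. \<alpha> n z *\<^sub>C D n) (poly b z *\<^sub>C g z)) (J (h z))" for z
  have int: "(\<integral>z. (\<Sum>n<N. coef n z * poly (r n) z) \<partial>circle_measure)
      = (\<Sum>n<N. coeff (r n) (\<kappa> n - 1) / of_nat (\<kappa> n))" for r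
  proof -
    have "(\<integral>z. (\<Sum>n<N. coef n z * poly (r n) z) \<partial>circle_measure)
        = (\<Sum>n<N. \<integral>z. coef n z * poly (r n) z \<partial>circle_measure)"
      by (rule Bochner_Integration.integral_sum) (intro integrable_circle_continuous continuous_intros)
    also have "\<dots> = (\<Sum>n<N. coeff (r n) (\<kappa> n - 1) / of_nat (\<kappa> n))"
      by (simp add: coef_def integral_circle_cnj_power_poly)
    finally show ?thesis .
  qed
  have eq1: "cinner (blinfun_apply (partial_symbol N z) (poly (a * b) z *\<^sub>C g z)) (J (h z))
      = (\<Sum>n<N. coef n z * poly (a * (b * Q n)) z)" for z
    unfolding partial_symbol_def scaleC_blinfun_sum_apply form_coef_sum Q by (simp add: mult_ac)
  have eq2: "W z = (\<Sum>n<N. coef n z * poly (cut n * (b * Q n)) z)" for z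
    unfolding W_def scaleC_blinfun_sum_apply form_coef_sum Q by (simp add: mult_ac \<alpha>_def)
  have "coeff (a * r) (\<kappa> n - 1) = coeff (cut n * r) (\<kappa> n - 1)" for n r
    unfolding coeff_mult using \<kappa>_pos[of n] by (intro sum.cong) (auto simp: cut_def coeff_poly_cutoff)
  then have "(\<integral>z. cinner (blinfun_apply (partial_symbol N z) (poly (a * b) z *\<^sub>C g z)) (J (h z)) \<partial>circle_measure)
      = integral\<^sup>L circle_measure W"
    unfolding eq1 eq2 int by simp
  also have "cmod \<dots> \<le> (\<integral>z. cmod (W z) \<partial>circle_measure)"
    by (rule integral_norm_bound)
  also have "\<dots> \<le> (\<integral>z. B * (sqrt (\<Sum>n<N. (cmod (\<alpha> n z))\<^sup>2) * norm (h z)) \<partial>circle_measure)"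
  proof (rule integral_mono)
    fix z assume "z \<in> space circle_measure"
    then have z: "z \<in> unit_circle" by (simp add: space_circle_measure)
    have "cmod (W z) \<le> norm (blinfun_apply (\<Sum>n<N. \<alpha> n z *\<^sub>C D n) (poly b z *\<^sub>C g z)) * norm (J (h z))"
      unfolding W_def by (rule cmod_cinner_le)
    also have "\<dots> \<le> (norm (\<Sum>n<N. \<alpha> n z *\<^sub>C D n) * norm (poly b z *\<^sub>C g z)) * norm (J (h z))"
      by (intro mult_right_mono norm_blinfun norm_ge_zero)
    also have "\<dots> \<le> (sqrt (\<Sum>n<N. (cmod (\<alpha> n z))\<^sup>2) * B) * norm (J (h z))"
      using B[OF z] by (intro mult_right_mono mult_mono l2) (auto simp: norm_scaleC g_def mult.commute sum_nonneg)
    also have "\<dots> = B * (sqrt (\<Sum>n<N. (cmod (\<alpha> n z))\<^sup>2) * norm (h z))"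
      by (simp add: antilinear_isometryD[OF J])
    finally show "cmod (W z) \<le> B * (sqrt (\<Sum>n<N. (cmod (\<alpha> n z))\<^sup>2) * norm (h z))" .
  next
    show "integrable circle_measure (\<lambda>z. cmod (W z))"
      unfolding eq2 by (intro integrable_circle_continuous continuous_intros)
    show "integrable circle_measure (\<lambda>z. B * (sqrt (\<Sum>n<N. (cmod (\<alpha> n z))\<^sup>2) * norm (h z)))"
      unfolding \<alpha>_def h_def by (intro integrable_circle_continuous continuous_intros)
  qed
  also have "\<dots> = B * (\<integral>z. sqrt (\<Sum>n<N. (cmod (\<alpha> n z))\<^sup>2) * norm (h z) \<partial>circle_measure)"
    by simp
  also have "(\<integral>z. sqrt (\<Sum>n<N. (cmod (\<alpha> n z))\<^sup>2) * norm (h z) \<partial>circle_measure)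
      \<le> sqrt (\<integral>z. (sqrt (\<Sum>n<N. (cmod (\<alpha> n z))\<^sup>2))\<^sup>2 \<partial>circle_measure) * sqrt (\<integral>z. (norm (h z))\<^sup>2 \<partial>circle_measure)"
    unfolding \<alpha>_def h_def
    by (rule integral_Cauchy_Schwarz)
      (intro integrable_circle_continuous continuous_on_circle_measurable continuous_intros)+
  also have "(\<integral>z. (sqrt (\<Sum>n<N. (cmod (\<alpha> n z))\<^sup>2))\<^sup>2 \<partial>circle_measure)
      \<le> 43 * (\<Sum>k\<le>degree a. (cmod (coeff a k))\<^sup>2 / (real (k + 1) * real (k + 2)))"
  proof -
    \<comment> \<open>On the circle \<open>coef n\<close> has constant modulus
      \<open>1 / \<kappa> n\<close>, so Parseval applies to the truncation alone. Running
      \<open>k\<close> up to \<open>degree a\<close> for every \<open>n\<close> prepares the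
      exchange of sums, which leaves for each \<open>k\<close> the lacunary sum over
      \<open>\<kappa> n > k\<close>.\<close>
    have one: "(\<integral>z. (cmod (\<alpha> n z))\<^sup>2 \<partial>circle_measure)
        = (\<Sum>k\<le>degree a. if k < \<kappa> n then (cmod (coeff a k))\<^sup>2 * (1 / (real (\<kappa> n))\<^sup>2) else 0)" for n
    proof -
      have "(\<integral>z. (cmod (\<alpha> n z))\<^sup>2 \<partial>circle_measure)
          = (\<integral>z. (1 / (real (\<kappa> n))\<^sup>2) * (cmod (poly (cut n) z))\<^sup>2 \<partial>circle_measure)"
        by (rule Bochner_Integration.integral_cong)
          (auto simp: \<alpha>_def norm_mult cmod_coef space_circle_measure power_mult_distrib power_divide)
      also have "\<dots> = (1 / (real (\<kappa> n))\<^sup>2) * (\<Sum>k\<le>degree a. (cmod (coeff (cut n) k))\<^sup>2)"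
        by (subst parseval_poly_upto[symmetric])
          (auto intro!: degree_le simp: cut_def coeff_poly_cutoff coeff_eq_0)
      also have "\<dots> = (\<Sum>k\<le>degree a. if k < \<kappa> n then (cmod (coeff a k))\<^sup>2 * (1 / (real (\<kappa> n))\<^sup>2) else 0)"
        unfolding sum_distrib_left by (intro sum.cong) (auto simp: cut_def coeff_poly_cutoff)
      finally show ?thesis .
    qed
    have "(\<integral>z. (sqrt (\<Sum>n<N. (cmod (\<alpha> n z))\<^sup>2))\<^sup>2 \<partial>circle_measure)
        = (\<integral>z. (\<Sum>n<N. (cmod (\<alpha> n z))\<^sup>2) \<partial>circle_measure)"
      by (simp add: sum_nonneg)
    also have "\<dots> = (\<Sum>n<N. \<integral>z. (cmod (\<alpha> n z))\<^sup>2 \<partial>circle_measure)"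
      unfolding \<alpha>_def
      by (rule Bochner_Integration.integral_sum) (intro integrable_circle_continuous continuous_intros)
    also have "\<dots> = (\<Sum>k\<le>degree a. \<Sum>n<N. if k < \<kappa> n then (cmod (coeff a k))\<^sup>2 * (1 / (real (\<kappa> n))\<^sup>2) else 0)"
      unfolding one by (rule sum.swap)
    also have "\<dots> = (\<Sum>k\<le>degree a. (cmod (coeff a k))\<^sup>2 * (\<Sum>n | n < N \<and> k < \<kappa> n. 1 / (real (\<kappa> n))\<^sup>2))"
      by (intro sum.cong refl) (simp add: sum_distrib_left sum.If_cases Int_def lessThan_def)
    also have "\<dots> \<le> (\<Sum>k\<le>degree a. (cmod (coeff a k))\<^sup>2 * (43 / (real (k + 1) * real (k + 2))))"
      by (intro sum_mono mult_left_mono sum_inverse_squares_lacunary \<kappa>) auto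
    finally show ?thesis by (simp add: sum_distrib_left mult_ac)
  qed
  finally show ?thesis
    using B0 unfolding g_def h_def L2_circle_norm_def
    by (simp add: mult_left_mono mult_right_mono)
qed

lemma partial_symbol_form_le:
  assumes "z \<in> unit_circle"
  shows "cmod (cinner (blinfun_apply (partial_symbol N z) x) (J y)) \<le> 2 * (norm x * norm y)"
proof -
  have "cmod (cinner (blinfun_apply (partial_symbol N z) x) (J y))
      \<le> norm (blinfun_apply (partial_symbol N z) x) * norm (J y)"
    by (rule cmod_cinner_le)
  also have "\<dots> \<le> (norm (partial_symbol N z) * norm x) * norm (J y)"
    by (intro mult_right_mono norm_blinfun norm_ge_zero)
  also have "\<dots> \<le> (2 * norm x) * norm (J y)"
    by (intro mult_right_mono norm_partial_symbol_le assms norm_ge_zero)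
  finally show ?thesis by (simp add: antilinear_isometryD[OF J])
qed

lemma continuous_on_partial_form:
  "continuous_on A (\<lambda>z. cinner (blinfun_apply (partial_symbol N z) (poly r z *\<^sub>C vec_poly Y p z)) (J (vec_poly X q z)))"
  unfolding partial_symbol_def scaleC_blinfun_sum_apply form_coef_sum
  by (intro continuous_intros cinner.continuous_on J_vec_poly_continuous)

text \<open>Here \<open>r\<close> is the scalar factor and \<open>b\<close> its approximate inverse;
  \<open>f'\<close> is split as \<open>f' r b + f' (1 - r b)\<close>. In 688 = 43 * 4 * 4 the
  factors come from lacunarity, from the Carleson embedding, and from comparing the norms of
  \<open>r\<close> and of the vector polynomial (2 from \<open>outer_approx\<close>, 2 from squaring
  a sum); 27 exceeds its square root.\<close>

lemma partial_form_bound: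
  fixes Y X :: "'h set"
  assumes F: "\<And>z. z \<in> unit_circle \<Longrightarrow> cmod (poly f z) \<le> F"
  shows "cmod (\<integral>z. cinner (blinfun_apply (partial_symbol N z) (poly (pderiv f) z *\<^sub>C vec_poly Y p z))
        (J (vec_poly X q z)) \<partial>circle_measure)
    \<le> 27 * F * (L2_circle_norm (vec_poly Y p) * L2_circle_norm (vec_poly X q))"
    (is "cmod ?I \<le> _")
proof -
  define G where "G = L2_circle_norm (vec_poly Y p)"
  define H where "H = L2_circle_norm (vec_poly X q)"
  have GH: "G \<ge> 0" "H \<ge> 0" by (auto simp: G_def H_def L2_circle_norm_nonneg)
  have F0: "F \<ge> 0" by (rule order_trans[OF norm_ge_zero F[of 1]]) simp
  have "continuous_on unit_circle (poly (pderiv f))" by (intro continuous_intros)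
  from continuous_on_circle_bounded[OF this]
  obtain B where B: "B > 0" "\<forall>z\<in>unit_circle. cmod (poly (pderiv f) z) \<le> B" by blast
  have step: "cmod ?I \<le> (1 + e) * (sqrt (688 * F\<^sup>2 * (G\<^sup>2 + e\<^sup>2)) * H) + 2 * B * e * (G * H)" if e: "e > 0" for e
  proof -
    have "continuous_on unit_circle (\<lambda>z. norm (vec_poly Y p z))" by (intro continuous_intros)
    from outer_approx[OF this norm_ge_zero e] obtain r b where
      rb: "\<And>z. z \<in> unit_circle \<Longrightarrow> cmod (1 - poly (r * b) z) \<le> e"
        "\<And>z. z \<in> unit_circle \<Longrightarrow> norm (vec_poly Y p z) * cmod (poly b z) \<le> 1 + e"
      and r: "(\<integral>z. (cmod (poly r z))\<^sup>2 \<partial>circle_measure) \<le> 2 * (\<integral>z. (norm (vec_poly Y p z) + e)\<^sup>2 \<partial>circle_measure)"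
      by blast
    have r': "(\<integral>z. (cmod (poly r z))\<^sup>2 \<partial>circle_measure) \<le> 4 * (G\<^sup>2 + e\<^sup>2)"
    proof -
      have "(\<integral>z. (norm (vec_poly Y p z) + e)\<^sup>2 \<partial>circle_measure)
          \<le> (\<integral>z. 2 * (norm (vec_poly Y p z))\<^sup>2 + 2 * e\<^sup>2 \<partial>circle_measure)"
      proof (rule integral_mono)
        show "(norm (vec_poly Y p z) + e)\<^sup>2 \<le> 2 * (norm (vec_poly Y p z))\<^sup>2 + 2 * e\<^sup>2" for z
          using sum_squares_bound[of "norm (vec_poly Y p z)" e] by (simp add: power2_sum)
      qed (intro integrable_circle_continuous continuous_intros)+
      also have "\<dots> = 2 * (\<integral>z. (norm (vec_poly Y p z))\<^sup>2 \<partial>circle_measure) + 2 * e\<^sup>2"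
        using L2_circleD(2)[OF vec_poly_L2_circle[of Y p]] by (simp add: space_circle_measure)
      also have "(\<integral>z. (norm (vec_poly Y p z))\<^sup>2 \<partial>circle_measure) = G\<^sup>2"
        by (simp add: G_def L2_circle_norm_def)
      finally show ?thesis using r by simp
    qed
    define I1 where "I1 = (\<lambda>z. cinner (blinfun_apply (partial_symbol N z)
      (poly (pderiv f * r * b) z *\<^sub>C vec_poly Y p z)) (J (vec_poly X q z)))"
    define I2 where "I2 = (\<lambda>z. cinner (blinfun_apply (partial_symbol N z)
      (poly (pderiv f * (1 - r * b)) z *\<^sub>C vec_poly Y p z)) (J (vec_poly X q z)))"
    have cont: "continuous_on A I1" "continuous_on A I2" for A
      unfolding I1_def I2_def by (intro continuous_on_partial_form)+
    have "poly (pderiv f) z *\<^sub>C vec_poly Y p z = poly (pderiv f * r * b) z *\<^sub>C vec_poly Y p z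
        + poly (pderiv f * (1 - r * b)) z *\<^sub>C vec_poly Y p z" for z
      unfolding scaleC_add_left[symmetric] poly_add[symmetric] by (simp add: algebra_simps)
    then have "?I = (\<integral>z. I1 z + I2 z \<partial>circle_measure)"
      unfolding I1_def I2_def by (simp add: blinfun.add_right cinner_add_left)
    also have "\<dots> = integral\<^sup>L circle_measure I1 + integral\<^sup>L circle_measure I2"
      by (rule Bochner_Integration.integral_add) (intro integrable_circle_continuous cont)+
    also have "cmod \<dots> \<le> cmod (integral\<^sup>L circle_measure I1) + cmod (integral\<^sup>L circle_measure I2)"
      by (rule norm_triangle_ineq)
    also have "cmod (integral\<^sup>L circle_measure I1) \<le> (1 + e) * (sqrt (43 * (\<Sum>k\<le>degree (pderiv f * r).
        (cmod (coeff (pderiv f * r) k))\<^sup>2 / (real (k + 1) * real (k + 2)))) * H)"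
      unfolding I1_def H_def by (rule partial_form_truncated) (use rb e in auto)
    also have "\<dots> \<le> (1 + e) * (sqrt (688 * F\<^sup>2 * (G\<^sup>2 + e\<^sup>2)) * H)"
    proof (intro mult_left_mono mult_right_mono real_sqrt_le_mono)
      have "(\<Sum>k\<le>degree (pderiv f * r). (cmod (coeff (pderiv f * r) k))\<^sup>2 / (real (k + 1) * real (k + 2)))
          \<le> (\<Sum>k\<le>degree f + degree r. (cmod (coeff (pderiv f * r) k))\<^sup>2 / (real (k + 1) * real (k + 2)))"
        using degree_mult_le[of "pderiv f" r] degree_pderiv[of f]
        by (intro sum_mono2) auto
      also have "\<dots> \<le> 4 * F\<^sup>2 * (\<integral>z. (cmod (poly r z))\<^sup>2 \<partial>circle_measure)"
        by (rule carleson_pderiv) (use F in auto)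
      also have "\<dots> \<le> 4 * F\<^sup>2 * (4 * (G\<^sup>2 + e\<^sup>2))"
        by (intro mult_left_mono r') auto
      finally have "43 * (\<Sum>k\<le>degree (pderiv f * r). (cmod (coeff (pderiv f * r) k))\<^sup>2 / (real (k + 1) * real (k + 2)))
          \<le> 43 * (4 * F\<^sup>2 * (4 * (G\<^sup>2 + e\<^sup>2)))"
        by (rule mult_left_mono) simp
      also have "\<dots> = 688 * F\<^sup>2 * (G\<^sup>2 + e\<^sup>2)" by simp
      finally show "43 * (\<Sum>k\<le>degree (pderiv f * r). (cmod (coeff (pderiv f * r) k))\<^sup>2 / (real (k + 1) * real (k + 2)))
          \<le> 688 * F\<^sup>2 * (G\<^sup>2 + e\<^sup>2)" .
    qed (use GH e in auto)
    \<comment> \<open>A crude estimate suffices here: \<open>B\<close> depends on \<open>f'\<close>,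
      but the factor \<open>e\<close> will make the term vanish.\<close>
    also have "cmod (integral\<^sup>L circle_measure I2) \<le> (2 * B * e) * (G * H)"
      unfolding G_def H_def
    proof (rule L2_product_bound(2)[OF vec_poly_L2_circle vec_poly_L2_circle])
      show "I2 \<in> borel_measurable circle_measure" by (rule continuous_on_circle_measurable[OF cont(2)])
      fix z assume z: "z \<in> unit_circle"
      have "cmod (I2 z) \<le> 2 * (norm (poly (pderiv f * (1 - r * b)) z *\<^sub>C vec_poly Y p z) * norm (vec_poly X q z))"
        unfolding I2_def by (rule partial_symbol_form_le[OF z])
      also have "norm (poly (pderiv f * (1 - r * b)) z *\<^sub>C vec_poly Y p z)
          = (cmod (poly (pderiv f) z) * cmod (1 - poly (r * b) z)) * norm (vec_poly Y p z)"
        by (simp add: norm_scaleC norm_mult)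
      also have "\<dots> \<le> (B * e) * norm (vec_poly Y p z)"
        using B z rb(1)[OF z] by (intro mult_right_mono mult_mono) auto
      finally show "cmod (I2 z) \<le> 2 * B * e * (norm (vec_poly Y p z) * norm (vec_poly X q z))"
        by (simp add: mult_ac mult_left_mono mult_right_mono)
    qed (use B e in auto)
    finally show ?thesis by simp
  qed
  \<comment> \<open>\<open>step\<close> holds for every positive \<open>e\<close>, while
    \<open>?I\<close>, \<open>B\<close>, \<open>G\<close> and \<open>H\<close> do not depend on
    \<open>e\<close>.\<close>
  have "cmod ?I \<le> (1 + 0) * (sqrt (688 * F\<^sup>2 * (G\<^sup>2 + 0\<^sup>2)) * H) + 2 * B * 0 * (G * H)"
  proof (rule tendsto_lowerbound)
    show "((\<lambda>e. (1 + e) * (sqrt (688 * F\<^sup>2 * (G\<^sup>2 + e\<^sup>2)) * H) + 2 * B * e * (G * H))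
      \<longlongrightarrow> (1 + 0) * (sqrt (688 * F\<^sup>2 * (G\<^sup>2 + 0\<^sup>2)) * H) + 2 * B * 0 * (G * H)) (at_right 0)"
      by (intro tendsto_intros)
    show "\<forall>\<^sub>F e in at_right 0. cmod ?I \<le> (1 + e) * (sqrt (688 * F\<^sup>2 * (G\<^sup>2 + e\<^sup>2)) * H) + 2 * B * e * (G * H)"
      using eventually_at_right_less[of 0] by eventually_elim (rule step)
  qed simp
  also have "\<dots> = sqrt 688 * (F * G * H)"
    using F0 GH by (simp add: real_sqrt_mult)
  also have "\<dots> \<le> 27 * (F * G * H)"
    using F0 GH by (intro mult_right_mono real_le_lsqrt) auto
  finally show ?thesis by (simp add: G_def H_def mult_ac)
qed

end

subsection \<open>The Hankel operator\<close>

lemma mult_L2_circle: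
  fixes g :: "complex \<Rightarrow> 'h::complex_hilbert_space"
  assumes c: "continuous_on UNIV c" and g: "g \<in> L2_circle"
  shows "(\<lambda>z. c z *\<^sub>C g z) \<in> L2_circle"
proof -
  have sm: "strongly_measurable circle_measure (\<lambda>z. c z *\<^sub>C g z)"
    by (rule strongly_measurable_compose2[OF strongly_measurable_circle_continuous[OF c] L2_circleD(1)[OF g]])
      (auto simp: case_prod_beta intro!: scaleC.continuous_on continuous_intros)
  obtain B where B: "\<forall>z\<in>unit_circle. cmod (c z) \<le> B"
    using continuous_on_circle_bounded[OF continuous_on_subset[OF c]] by auto
  have "integrable circle_measure (\<lambda>z. (norm (c z *\<^sub>C g z))\<^sup>2)"
  proof (rule Bochner_Integration.integrable_bound)
    show "integrable circle_measure (\<lambda>z. B\<^sup>2 * (norm (g z))\<^sup>2)"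
      using L2_circleD(2)[OF g] by simp
    note [measurable] = strongly_measurable_circle_norm[OF sm]
    show "(\<lambda>z. (norm (c z *\<^sub>C g z))\<^sup>2) \<in> borel_measurable circle_measure" by measurable
    show "AE z in circle_measure. norm ((norm (c z *\<^sub>C g z))\<^sup>2) \<le> norm (B\<^sup>2 * (norm (g z))\<^sup>2)"
      using B by (auto intro!: AE_I2 mult_right_mono power_mono simp: space_circle_measure norm_scaleC power_mult_distrib)
  qed
  with sm show ?thesis by (simp add: L2_circle_def)
qed

section \<open>The full symbol as the limit of its partial sums\<close>

context lacunary_hankel
begin

definition symbol :: "complex \<Rightarrow> 'h \<Rightarrow>\<^sub>L 'h" where
  "symbol z = (\<Sum>n. coef n z *\<^sub>C D n)"

lemma partial_symbol_tendsto:
  assumes "z \<in> unit_circle"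
  shows "(\<lambda>N. partial_symbol N z) \<longlonglongrightarrow> symbol z"
proof -
  have "summable (\<lambda>n. coef n z *\<^sub>C D n)"
    by (rule summable_comparison_test'[of "\<lambda>n. (1/2) ^ n" 0]) (use norm_coef_D_le[OF assms] in \<open>auto intro: summable_geometric\<close>)
  then show ?thesis unfolding partial_symbol_def symbol_def by (rule summable_LIMSEQ)
qed

lemma partial_form_tendsto_pointwise:
  assumes "z \<in> unit_circle"
  shows "(\<lambda>N. cinner (blinfun_apply (partial_symbol N z) x) y) \<longlonglongrightarrow> cinner (blinfun_apply (symbol z) x) y"
  by (intro cinner.tendsto blinfun.tendsto partial_symbol_tendsto[OF assms] tendsto_const)

lemma norm_symbol_le: "z \<in> unit_circle \<Longrightarrow> norm (symbol z) \<le> 2"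
  by (rule tendsto_upperbound[OF tendsto_norm[OF partial_symbol_tendsto]])
    (auto intro!: always_eventually norm_partial_symbol_le)

lemma symbol_form_le:
  assumes "z \<in> unit_circle"
  shows "cmod (cinner (blinfun_apply (symbol z) x) (J y)) \<le> 2 * (norm x * norm y)"
  by (rule tendsto_upperbound[OF tendsto_norm[OF partial_form_tendsto_pointwise[OF assms]]])
    (auto intro!: always_eventually partial_symbol_form_le assms)

lemma partial_form_measurable:
  assumes g: "g \<in> L2_circle" and h: "h \<in> L2_circle"
  shows "(\<lambda>z. cinner (blinfun_apply (partial_symbol N z) (g z)) (J (h z))) \<in> borel_measurable circle_measure"
proof -
  have [measurable]: "(\<lambda>z. cinner (blinfun_apply (D n) (g z)) (J (h z))) \<in> borel_measurable circle_measure" for n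
    by (intro strongly_measurable_circle_borel strongly_measurable_cinner
        strongly_measurable_compose[OF L2_circleD(1)[OF g]] strongly_measurable_compose[OF L2_circleD(1)[OF h]]
        linear_continuous_on antilinear_isometry_bounded_linear[OF J] blinfun.bounded_linear_right)
  have [measurable]: "coef n \<in> borel_measurable circle_measure" for n
    by (intro continuous_on_circle_measurable continuous_intros)
  show ?thesis
    unfolding partial_symbol_def scaleC_blinfun_sum_apply cinner.sum_left cinner_scaleC_left by measurable
qed

lemma form_measurable:
  assumes g: "g \<in> L2_circle" and h: "h \<in> L2_circle"
  shows "(\<lambda>z. cinner (blinfun_apply (symbol z) (g z)) (J (h z))) \<in> borel_measurable circle_measure"
  by (rule borel_measurable_LIMSEQ_metric[OF partial_form_measurable[OF g h]])
    (auto simp: space_circle_measure intro!: partial_form_tendsto_pointwise)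

lemma form_integrable:
  assumes g: "g \<in> L2_circle" and h: "h \<in> L2_circle"
  shows "integrable circle_measure (\<lambda>z. cinner (blinfun_apply (symbol z) (g z)) (J (h z)))"
  by (rule L2_product_bound(1)[OF g h form_measurable[OF g h] symbol_form_le]) auto

text \<open>Dominated convergence, thanks to the bound 2 on all partial symbols. It carries to the
  full symbol both the estimate for vector polynomials and the evaluation at constant
  functions.\<close>

lemma partial_form_tendsto:
  assumes g: "g \<in> L2_circle" and h: "h \<in> L2_circle"
  shows "(\<lambda>N. \<integral>z. cinner (blinfun_apply (partial_symbol N z) (g z)) (J (h z)) \<partial>circle_measure)
    \<longlonglongrightarrow> (\<integral>z. cinner (blinfun_apply (symbol z) (g z)) (J (h z)) \<partial>circle_measure)"
proof (rule integral_dominated_convergence[where w = "\<lambda>z. 2 * (norm (g z) * norm (h z))"])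
  show "integrable circle_measure (\<lambda>z. 2 * (norm (g z) * norm (h z)))"
    by (intro integrable_mult_right integrable_mult_of_squares strongly_measurable_circle_norm L2_circleD g h)
qed (auto intro!: AE_I2 partial_form_measurable form_measurable g h partial_form_tendsto_pointwise
    partial_symbol_form_le simp: space_circle_measure)

lemma symbol_clinear:
  assumes "z \<in> unit_circle"
  shows "symbol z \<in> bounded_clinear_ops"
proof -
  have "blinfun_apply (symbol z) (a *\<^sub>C x) = a *\<^sub>C blinfun_apply (symbol z) x" for a x
  proof (rule LIMSEQ_unique)
    show "(\<lambda>N. blinfun_apply (partial_symbol N z) (a *\<^sub>C x)) \<longlonglongrightarrow> blinfun_apply (symbol z) (a *\<^sub>C x)"
      by (intro blinfun.tendsto partial_symbol_tendsto[OF assms] tendsto_const)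
    have "blinfun_apply (partial_symbol N z) (a *\<^sub>C x) = a *\<^sub>C blinfun_apply (partial_symbol N z) x" for N
      by (simp add: partial_symbol_def scaleC_blinfun_sum_apply D_scaleC scaleC.sum_right scaleC_scaleC mult.commute)
    then show "(\<lambda>N. blinfun_apply (partial_symbol N z) (a *\<^sub>C x)) \<longlonglongrightarrow> a *\<^sub>C blinfun_apply (symbol z) x"
      by (auto intro!: scaleC.tendsto blinfun.tendsto partial_symbol_tendsto[OF assms] tendsto_const)
  qed
  then show ?thesis by (simp add: bounded_clinear_ops_def)
qed

lemma symbol_Linf:
  assumes "surj J"
  shows "symbol \<in> Linf_ops"
  unfolding Linf_ops_def mem_Collect_eq
proof (intro conjI allI ballI)
  fix x y
  obtain y' where "y = J y'" using assms by (metis surjD)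
  then show "(\<lambda>z. cinner (blinfun_apply (symbol z) x) y) \<in> borel_measurable circle_measure"
    using form_measurable[OF const_L2_circle[of x] const_L2_circle[of y']] by simp
  show "\<exists>B. \<forall>z\<in>unit_circle. norm (symbol z) \<le> B" using norm_symbol_le by blast
qed (rule symbol_clinear)

lemma hankel_vec_poly_bound:
  assumes F: "\<And>z. z \<in> unit_circle \<Longrightarrow> cmod (poly f z) \<le> F"
  shows "cmod (hankel_op J symbol (mult_op (poly (pderiv f)) (vec_poly Y p)) (vec_poly X q))
    \<le> 27 * F * (L2_circle_norm (vec_poly Y p) * L2_circle_norm (vec_poly X q))"
proof -
  have "(\<lambda>z. poly (pderiv f) z *\<^sub>C vec_poly Y p z) \<in> L2_circle"
    by (intro mult_L2_circle vec_poly_L2_circle continuous_intros)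
  from tendsto_norm[OF partial_form_tendsto[OF this vec_poly_L2_circle]] show ?thesis
    unfolding hankel_op_def mult_op_def
    by (rule tendsto_upperbound) (auto intro!: always_eventually partial_form_bound F)
qed

section \<open>From vector polynomials to all of \<open>H^2(H)\<close>\<close>

lemma L2_circle_norm_sq: "(L2_circle_norm g)\<^sup>2 = (\<integral>z. (norm (g z))\<^sup>2 \<partial>circle_measure)"
  by (simp add: L2_circle_norm_def)

text \<open>Keeps the approximants of unit vectors at squared norm at most
  \<open>2 + 2 * e^2\<close>; the leading 2 is what doubles 27 to 54 in the next bound.\<close>

lemma L2_circle_norm_le_diff:
  fixes g G :: "complex \<Rightarrow> 'h"
  assumes g: "g \<in> L2_circle" and G: "G \<in> L2_circle"
  shows "(L2_circle_norm G)\<^sup>2 \<le> 2 * (L2_circle_norm g)\<^sup>2 + 2 * (L2_circle_norm (\<lambda>z. g z - G z))\<^sup>2"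
proof -
  have ints: "integrable circle_measure (\<lambda>z. (norm (g z))\<^sup>2)"
    "integrable circle_measure (\<lambda>z. (norm (g z - G z))\<^sup>2)"
    using L2_circleD(2)[OF g] L2_circleD(2)[OF L2_circle_diff[OF g G]] by auto
  have "(\<integral>z. (norm (G z))\<^sup>2 \<partial>circle_measure) \<le> (\<integral>z. 2 * (norm (g z))\<^sup>2 + 2 * (norm (g z - G z))\<^sup>2 \<partial>circle_measure)"
  proof (rule integral_mono)
    show "(norm (G z))\<^sup>2 \<le> 2 * (norm (g z))\<^sup>2 + 2 * (norm (g z - G z))\<^sup>2" for z
      using norm_diff_sq_le[of 0 "G z" "g z"] by simp
  qed (use L2_circleD(2)[OF G] ints in auto)
  then show ?thesis unfolding L2_circle_norm_sq using ints by simp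
qed

lemma hankel_diff:
  assumes "g \<in> L2_circle" "g' \<in> L2_circle" "h \<in> L2_circle" "h' \<in> L2_circle"
  shows "hankel_op J symbol g h = hankel_op J symbol g' h'
    + hankel_op J symbol (\<lambda>z. g z - g' z) h + hankel_op J symbol g' (\<lambda>z. h z - h' z)"
proof -
  note J_diff = linear_diff[OF bounded_linear.linear[OF antilinear_isometry_bounded_linear[OF J]]]
  have "hankel_op J symbol (\<lambda>z. g z - g' z) h = hankel_op J symbol g h - hankel_op J symbol g' h"
    unfolding hankel_op_def blinfun.diff_right cinner.diff_left
    by (rule Bochner_Integration.integral_diff) (intro form_integrable assms)+
  moreover have "hankel_op J symbol g' (\<lambda>z. h z - h' z) = hankel_op J symbol g' h - hankel_op J symbol g' h'"
    unfolding hankel_op_def J_diff cinner.diff_right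
    by (rule Bochner_Integration.integral_diff) (intro form_integrable assms)+
  ultimately show ?thesis by simp
qed

lemma hankel_mult_bound:
  assumes g: "g \<in> L2_circle" and h: "h \<in> L2_circle"
    and B: "\<And>z. z \<in> unit_circle \<Longrightarrow> cmod (poly r z) \<le> B" "B \<ge> 0"
  shows "cmod (hankel_op J symbol (mult_op (poly r) g) h) \<le> 2 * B * (L2_circle_norm g * L2_circle_norm h)"
  unfolding hankel_op_def mult_op_def
proof (rule L2_product_bound(2)[OF g h])
  show "(\<lambda>z. cinner (blinfun_apply (symbol z) (poly r z *\<^sub>C g z)) (J (h z))) \<in> borel_measurable circle_measure"
    by (intro form_measurable mult_L2_circle g h continuous_intros)
  fix z assume z: "z \<in> unit_circle"
  have "cmod (cinner (blinfun_apply (symbol z) (poly r z *\<^sub>C g z)) (J (h z))) \<le> 2 * (norm (poly r z *\<^sub>C g z) * norm (h z))"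
    by (rule symbol_form_le[OF z])
  also have "\<dots> \<le> 2 * (B * norm (g z) * norm (h z))"
    unfolding norm_scaleC by (intro mult_left_mono mult_right_mono B(1)[OF z]) auto
  finally show "cmod (cinner (blinfun_apply (symbol z) (poly r z *\<^sub>C g z)) (J (h z)))
    \<le> 2 * B * (norm (g z) * norm (h z))" by (simp add: mult_ac)
qed (use B in auto)

text \<open>Both arguments are replaced by vector polynomials within \<open>e\<close>. The two
  errors are of order \<open>e\<close> times the supremum \<open>B\<close> of \<open>|f'|\<close>,
  so they disappear as \<open>e\<close> tends to 0 with \<open>f\<close> fixed.\<close>

lemma hankel_hardy2_bound:
  assumes F: "\<And>z. z \<in> unit_circle \<Longrightarrow> cmod (poly f z) \<le> F"
    and g: "g \<in> hardy2" "L2_circle_norm g \<le> 1" and h: "h \<in> hardy2" "L2_circle_norm h \<le> 1"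
  shows "cmod (hankel_op J symbol (mult_op (poly (pderiv f)) g) h) \<le> 54 * F"
proof -
  have g2: "g \<in> L2_circle" and h2: "h \<in> L2_circle" using g h by (auto simp: hardy2_def)
  have F0: "F \<ge> 0" by (rule order_trans[OF norm_ge_zero F[of 1]]) simp
  have "continuous_on unit_circle (poly (pderiv f))" by (intro continuous_intros)
  from continuous_on_circle_bounded[OF this]
  obtain B where B: "B > 0" "\<And>z. z \<in> unit_circle \<Longrightarrow> cmod (poly (pderiv f) z) \<le> B" by blast
  let ?I = "hankel_op J symbol (mult_op (poly (pderiv f)) g) h"
  have step: "cmod ?I \<le> 27 * F * (2 + 2 * e\<^sup>2) + 2 * B * e + 2 * B * (sqrt (2 + 2 * e\<^sup>2) * e)" if e: "e > 0" for e
  proof -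
    have approx: "\<exists>Y p. L2_circle_norm (\<lambda>z. k z - vec_poly Y p z) \<le> e \<and> L2_circle_norm (vec_poly Y p) \<le> sqrt (2 + 2 * e\<^sup>2)"
      if k: "k \<in> hardy2" "L2_circle_norm k \<le> 1" for k :: "complex \<Rightarrow> 'h"
    proof -
      have k2: "k \<in> L2_circle" using k by (simp add: hardy2_def)
      obtain Y p where "(\<integral>z. (norm (k z - vec_poly Y p z))\<^sup>2 \<partial>circle_measure) < e\<^sup>2"
        using hardy2_poly_approx[OF k(1), of "e\<^sup>2"] e by auto
      then have le: "(L2_circle_norm (\<lambda>z. k z - vec_poly Y p z))\<^sup>2 \<le> e\<^sup>2"
        by (simp add: L2_circle_norm_sq)
      have "(L2_circle_norm (vec_poly Y p))\<^sup>2 \<le> 2 * (L2_circle_norm k)\<^sup>2 + 2 * (L2_circle_norm (\<lambda>z. k z - vec_poly Y p z))\<^sup>2"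
        by (rule L2_circle_norm_le_diff[OF k2 vec_poly_L2_circle])
      also have "\<dots> \<le> 2 * 1\<^sup>2 + 2 * e\<^sup>2"
        using le power_mono[OF k(2) L2_circle_norm_nonneg, of 2] by simp
      finally have "L2_circle_norm (vec_poly Y p) \<le> sqrt (2 + 2 * e\<^sup>2)"
        by (intro real_le_rsqrt) simp
      moreover have "L2_circle_norm (\<lambda>z. k z - vec_poly Y p z) \<le> e"
        using power2_le_imp_le[OF le] e by simp
      ultimately show ?thesis by blast
    qed
    obtain Y p where G: "L2_circle_norm (\<lambda>z. g z - vec_poly Y p z) \<le> e" "L2_circle_norm (vec_poly Y p) \<le> sqrt (2 + 2 * e\<^sup>2)"
      using approx[OF g] by blast
    obtain X q where H: "L2_circle_norm (\<lambda>z. h z - vec_poly X q z) \<le> e" "L2_circle_norm (vec_poly X q) \<le> sqrt (2 + 2 * e\<^sup>2)"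
      using approx[OF h] by blast
    define S where "S = sqrt (2 + 2 * e\<^sup>2)"
    have S: "S \<ge> 0" "S * S = 2 + 2 * e\<^sup>2" by (simp_all add: S_def)
    have mult2: "mult_op (poly (pderiv f)) k \<in> L2_circle" if "k \<in> L2_circle" for k :: "complex \<Rightarrow> 'h"
      unfolding mult_op_def by (intro mult_L2_circle that continuous_intros)
    have md: "(\<lambda>z. mult_op (poly (pderiv f)) g z - mult_op (poly (pderiv f)) (vec_poly Y p) z)
        = mult_op (poly (pderiv f)) (\<lambda>z. g z - vec_poly Y p z)"
      by (simp add: mult_op_def scaleC.diff_right)
    have "?I = hankel_op J symbol (mult_op (poly (pderiv f)) (vec_poly Y p)) (vec_poly X q)
        + hankel_op J symbol (mult_op (poly (pderiv f)) (\<lambda>z. g z - vec_poly Y p z)) h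
        + hankel_op J symbol (mult_op (poly (pderiv f)) (vec_poly Y p)) (\<lambda>z. h z - vec_poly X q z)"
      (is "_ = ?A1 + ?A2 + ?A3")
      unfolding md[symmetric] by (intro hankel_diff mult2 g2 h2 vec_poly_L2_circle)
    then have "cmod ?I \<le> cmod ?A1 + cmod ?A2 + cmod ?A3"
      using norm_triangle_ineq[of "?A1 + ?A2" ?A3] norm_triangle_ineq[of ?A1 ?A2] by simp
    also have "\<dots> \<le> 27 * F * (L2_circle_norm (vec_poly Y p) * L2_circle_norm (vec_poly X q))
        + 2 * B * (L2_circle_norm (\<lambda>z. g z - vec_poly Y p z) * L2_circle_norm h)
        + 2 * B * (L2_circle_norm (vec_poly Y p) * L2_circle_norm (\<lambda>z. h z - vec_poly X q z))"
      using B by (intro add_mono hankel_vec_poly_bound F hankel_mult_bound L2_circle_diff vec_poly_L2_circle g2 h2) auto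
    also have "\<dots> \<le> 27 * F * (S * S) + 2 * B * (e * 1) + 2 * B * (S * e)"
      using G H h(2) F0 B e S(1)
      by (intro add_mono mult_left_mono mult_mono) (auto simp: S_def L2_circle_norm_nonneg)
    finally show ?thesis unfolding S(2) by (simp add: S_def)
  qed
  have "cmod ?I \<le> 27 * F * (2 + 2 * 0\<^sup>2) + 2 * B * 0 + 2 * B * (sqrt (2 + 2 * 0\<^sup>2) * 0)"
  proof (rule tendsto_lowerbound)
    show "((\<lambda>e. 27 * F * (2 + 2 * e\<^sup>2) + 2 * B * e + 2 * B * (sqrt (2 + 2 * e\<^sup>2) * e))
      \<longlongrightarrow> 27 * F * (2 + 2 * 0\<^sup>2) + 2 * B * 0 + 2 * B * (sqrt (2 + 2 * 0\<^sup>2) * 0)) (at_right 0)"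
      by (intro tendsto_intros)
    show "\<forall>\<^sub>F e in at_right 0. cmod ?I \<le> 27 * F * (2 + 2 * e\<^sup>2) + 2 * B * e + 2 * B * (sqrt (2 + 2 * e\<^sup>2) * e)"
      using eventually_at_right_less[of 0] by eventually_elim (rule step)
  qed simp
  then show ?thesis by simp
qed

lemma hankel_op_norm_bound:
  "hardy2_op_norm (hankel_op J symbol \<circ> mult_op (poly (pderiv f))) \<le> ennreal (54 * circle_sup_norm (poly f))"
proof -
  have "continuous_on unit_circle (poly f)" by (intro continuous_intros)
  from continuous_on_circle_bounded[OF this] obtain B where "\<forall>z\<in>unit_circle. cmod (poly f z) \<le> B"
    by blast
  then have "bdd_above ((\<lambda>z. cmod (poly f z)) ` unit_circle)"
    by (intro bdd_aboveI2[where M = B]) blast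
  then have F: "cmod (poly f z) \<le> circle_sup_norm (poly f)" if "z \<in> unit_circle" for z
    unfolding circle_sup_norm_def by (rule cSUP_upper[OF that])
  show ?thesis
    unfolding hardy2_op_norm_def hardy2_dual_norm_def comp_def
  proof (intro SUP_least ennreal_leI)
    fix g h :: "complex \<Rightarrow> 'h"
    assume "g \<in> {g \<in> hardy2. L2_circle_norm g \<le> 1}" "h \<in> {h \<in> hardy2. L2_circle_norm h \<le> 1}"
    then show "cmod (hankel_op J symbol (mult_op (poly (pderiv f)) g) h) \<le> 54 * circle_sup_norm (poly f)"
      using hankel_hardy2_bound[OF F] by blast
  qed
qed

text \<open>The \<open>n\<close>-th term of the symbol extracts \<open>coeff P (\<kappa> n)\<close>
  from \<open>P'\<close>. Since \<open>\<kappa> n \<ge> 2^n > n\<close>, these coefficients vanish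
  for \<open>n \<ge> degree P\<close>, so the partial sums converging to the Hankel form are
  eventually constant.\<close>

lemma hankel_pderiv_const:
  assumes N: "degree P \<le> N"
  shows "hankel_op J symbol (mult_op (poly (pderiv P)) (\<lambda>z. x)) (\<lambda>z. y)
    = cinner (blinfun_apply (\<Sum>n<N. coeff P (\<kappa> n) *\<^sub>C D n) x) (J y)"
proof -
  have coeff: "coeff (pderiv P) (\<kappa> n - 1) / of_nat (\<kappa> n) = coeff P (\<kappa> n)" for n
    using \<kappa>_pos[of n] by (simp add: coeff_pderiv)
  have part: "(\<integral>z. cinner (blinfun_apply (partial_symbol M z) (poly (pderiv P) z *\<^sub>C x)) (J y) \<partial>circle_measure)
      = (\<Sum>n<M. coeff P (\<kappa> n) * cinner (blinfun_apply (D n) x) (J y))" for M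
  proof -
    have "(\<integral>z. cinner (blinfun_apply (partial_symbol M z) (poly (pderiv P) z *\<^sub>C x)) (J y) \<partial>circle_measure)
        = (\<integral>z. (\<Sum>n<M. coef n z * poly (pderiv P) z * cinner (blinfun_apply (D n) x) (J y)) \<partial>circle_measure)"
      unfolding partial_symbol_def scaleC_blinfun_sum_apply form_coef_sum by (simp add: mult_ac)
    also have "\<dots> = (\<Sum>n<M. \<integral>z. coef n z * poly (pderiv P) z * cinner (blinfun_apply (D n) x) (J y) \<partial>circle_measure)"
      by (rule Bochner_Integration.integral_sum) (intro integrable_circle_continuous continuous_intros)
    also have "\<dots> = (\<Sum>n<M. coeff (pderiv P) (\<kappa> n - 1) / of_nat (\<kappa> n) * cinner (blinfun_apply (D n) x) (J y))"
      by (simp add: coef_def integral_circle_cnj_power_poly)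
    also have "\<dots> = (\<Sum>n<M. coeff P (\<kappa> n) * cinner (blinfun_apply (D n) x) (J y))"
      unfolding coeff ..
    finally show ?thesis .
  qed
  have zero: "coeff P (\<kappa> n) = 0" if "n \<ge> N" for n
  proof (rule coeff_eq_0)
    have "n < 2 ^ n" by (rule less_exp)
    then show "degree P < \<kappa> n" using N that \<kappa>(1)[of n] by linarith
  qed
  have "\<forall>\<^sub>F M in sequentially. (\<Sum>n<M. coeff P (\<kappa> n) * cinner (blinfun_apply (D n) x) (J y))
      = (\<Sum>n<N. coeff P (\<kappa> n) * cinner (blinfun_apply (D n) x) (J y))"
    using eventually_ge_at_top[of N]
  proof eventually_elim
    case (elim M)
    then show ?case by (intro sum.mono_neutral_right) (auto simp: zero)
  qed
  then have "(\<lambda>M. \<Sum>n<M. coeff P (\<kappa> n) * cinner (blinfun_apply (D n) x) (J y))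
      \<longlonglongrightarrow> (\<Sum>n<N. coeff P (\<kappa> n) * cinner (blinfun_apply (D n) x) (J y))"
    by (rule tendsto_eventually)
  moreover have "(\<lambda>z. poly (pderiv P) z *\<^sub>C x) \<in> L2_circle"
    by (intro mult_L2_circle const_L2_circle continuous_intros)
  from partial_form_tendsto[OF this const_L2_circle[of y]]
  have "(\<lambda>M. \<Sum>n<M. coeff P (\<kappa> n) * cinner (blinfun_apply (D n) x) (J y))
      \<longlonglongrightarrow> hankel_op J symbol (mult_op (poly (pderiv P)) (\<lambda>z. x)) (\<lambda>z. y)"
    unfolding part hankel_op_def mult_op_def .
  ultimately have "hankel_op J symbol (mult_op (poly (pderiv P)) (\<lambda>z. x)) (\<lambda>z. y)
      = (\<Sum>n<N. coeff P (\<kappa> n) * cinner (blinfun_apply (D n) x) (J y))"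
    by (intro LIMSEQ_unique)
  then show ?thesis
    by (simp add: scaleC_blinfun_sum_apply cinner.sum_left cinner_scaleC_left)
qed

end

theorem theorem1p1:
  fixes C :: "nat \<Rightarrow> 'h::complex_hilbert_space \<Rightarrow>\<^sub>L 'h"
    and K :: "nat \<Rightarrow> nat"
    and J :: "'h \<Rightarrow> 'h"
    and u :: "(complex \<Rightarrow> complex) \<Rightarrow> 'h \<Rightarrow>\<^sub>L 'h"
  assumes J: "antilinear_isometry J" "surj J"
    and C_ops: "\<And>n. n \<ge> 1 \<Longrightarrow> C n \<in> bounded_clinear_ops"
    and C_norm: "\<And>\<alpha> :: nat \<Rightarrow> complex. summable (\<lambda>n. (cmod (\<alpha> (Suc n)))\<^sup>2) \<Longrightarrow>
           norm (\<Sum>n. \<alpha> (Suc n) *\<^sub>C C (Suc n)) \<le> sqrt (\<Sum>n. (cmod (\<alpha> (Suc n)))\<^sup>2)"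
    and K_pos: "\<And>n. n \<ge> 1 \<Longrightarrow> K n > 0"
    and K_incr: "strict_mono_on {1..} K"
    and K_lac: "\<And>n. n > 1 \<Longrightarrow> 2 ^ (n - 1) < K n \<and> K n \<le> 2 ^ n"
    and u: "\<And>F. F \<in> disc_algebra \<Longrightarrow>
           u F = (\<Sum>n. fourier_coeff F (int (K (Suc n))) *\<^sub>C C (Suc n))"
  shows "\<exists>\<phi>\<in>Linf_ops.
      (\<exists>c::real. \<forall>f :: complex poly.
         hardy2_op_norm (hankel_op J \<phi> \<circ> mult_op (poly (pderiv f))) \<le> ennreal (c * circle_sup_norm (poly f))) \<and>
      (\<forall>(P :: complex poly) x y.
         cinner (blinfun_apply (u (poly P)) x) (J y)
           = hankel_op J \<phi> (mult_op (poly (pderiv P)) (\<lambda>z. x)) (\<lambda>z. y))"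
proof -
  have zero: "(0 :: complex) *\<^sub>C T = 0" for T :: "'h \<Rightarrow>\<^sub>L 'h"
    by (rule blinfun_eqI) (simp add: scaleC_blinfun.rep_eq scaleC.zero_left)
  have K_lower: "2 ^ n \<le> K (Suc n)" for n
    using K_pos[of 1] K_lac[of "Suc n"] by (cases n) (auto simp: Suc_le_eq)
  have K_upper: "K (Suc n) \<le> 2 ^ (n + 2)" for n
  proof (cases n)
    case 0
    \<comment> \<open>The dyadic condition starts at index 2, so \<open>K 1\<close> is bounded
      through monotonicity, by \<open>K 2 \<le> 4\<close>.\<close>
    have "K 1 < K 2" by (rule strict_mono_onD[OF K_incr]) auto
    then show ?thesis using K_lac[of 2] 0 by simp
  next
    case (Suc m)
    have "K (Suc n) \<le> 2 ^ Suc n" using K_lac[of "Suc n"] Suc by simp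
    also have "\<dots> \<le> 2 ^ (n + 2)" by (rule power_increasing) auto
    finally show ?thesis .
  qed
  interpret lacunary_hankel "\<lambda>n. K (Suc n)" "\<lambda>n. C (Suc n)" J
  proof
    fix N and \<alpha> :: "nat \<Rightarrow> complex"
    \<comment> \<open>Zero padding makes the finite family square summable; the index shift gives
      \<open>\<beta> (Suc n) = \<alpha> n\<close> exactly for \<open>n < N\<close>.\<close>
    define \<beta> where "\<beta> n = (if n \<le> N then \<alpha> (n - 1) else 0)" for n
    have 1: "(\<Sum>n. \<beta> (Suc n) *\<^sub>C C (Suc n)) = (\<Sum>n<N. \<alpha> n *\<^sub>C C (Suc n))"
      by (subst suminf_finite[of "{..<N}"]) (auto simp: \<beta>_def zero)
    have 2: "(\<Sum>n. (cmod (\<beta> (Suc n)))\<^sup>2) = (\<Sum>n<N. (cmod (\<alpha> n))\<^sup>2)"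
      by (subst suminf_finite[of "{..<N}"]) (auto simp: \<beta>_def)
    have "summable (\<lambda>n. (cmod (\<beta> (Suc n)))\<^sup>2)"
      by (rule summable_finite[of "{..<N}"]) (auto simp: \<beta>_def)
    from C_norm[OF this] show "norm (\<Sum>n<N. \<alpha> n *\<^sub>C C (Suc n)) \<le> sqrt (\<Sum>n<N. (cmod (\<alpha> n))\<^sup>2)"
      unfolding 1 2 .
  qed (use J C_ops K_lower K_upper in auto)
  have "cinner (blinfun_apply (u (poly P)) x) (J y) = hankel_op J symbol (mult_op (poly (pderiv P)) (\<lambda>z. x)) (\<lambda>z. y)"
    for P x y
  proof -
    have "u (poly P) = (\<Sum>n. coeff P (K (Suc n)) *\<^sub>C C (Suc n))"
      unfolding u[OF poly_in_disc_algebra] fourier_coeff_poly ..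
    also have "\<dots> = (\<Sum>n<degree P. coeff P (K (Suc n)) *\<^sub>C C (Suc n))"
    proof (rule suminf_finite)
      fix n assume "n \<notin> {..<degree P}"
      then have "degree P < K (Suc n)"
        using K_lower[of n] less_exp[of n] unfolding lessThan_iff by linarith
      then show "coeff P (K (Suc n)) *\<^sub>C C (Suc n) = 0" by (simp add: coeff_eq_0 zero)
    qed simp
    finally show ?thesis by (simp add: hankel_pderiv_const[OF order_refl])
  qed
  then show ?thesis
    by (intro bexI[OF _ symbol_Linf[OF assms(2)]] conjI allI exI[of _ 54] hankel_op_norm_bound)
qed

end
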